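(* Let $b\ge2$ be an integer, $\theta\in(0,1)$ irrational, $\rho\in[0,1)$, and let $\xi$ be one of the numbers $\xi_b(\theta,\rho)$ or $\xi'_b(\theta,\rho)$, with attached digit sequence $(b_k)_{k\ge1}$ and quantities $t_k,r_k,c_k,d_k,e_k,f_k$ as defined in the context. If $a_k-b_k\ge2$ and $b_k\ge1$ for every $k\ge1$, then the continued fraction expansion of $\xi$ is $$\xi=[0;c_0+1,e_0,f_0,c_1,d_1,1,e_1,f_1,c_2,d_2,1,e_2,f_2,c_3,\dots].$$ Otherwise, let $A_1,A_2,A_3,\dots$ be the sequence of positive integers obtained from the sequence $c_0,d_0,1,e_0,f_0,c_1,d_1,1,e_1,f_1,c_2,\dots$ by applying the following rules: (i) for every $k$ such that $c_{k+1}<0$, replace the nine consecutive integers $c_k,d_k,1,e_k,f_k,c_{k+1},d_{k+1},1,e_{k+1}$ by the single positive integer $c_k+1+e_{k+1}$; (ii) in the resulting sequence, replace any three consecutive elements of the form $x,0,y$ by the single integer $x+y$. Then the continued fraction expansion of $\xi$ is $\xi=[0;A_1,A_2,A_3,\dots]$.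
   Context: Let $\theta=[0;a_1,a_2,\dots]$ with convergents $p_k/q_k$ ($q_{-1}=0,q_0=1,p_{-1}=1,p_0=0$, $q_k=a_kq_{k-1}+q_{k-2}$), and $\theta_k=q_k\theta-p_k$. For $n\ge1$, $s_n=\lfloor n\theta+\rho\rfloor-\lfloor(n-1)\theta+\rho\rfloor$, $s'_n=\lceil n\theta+\rho\rceil-\lceil(n-1)\theta+\rho\rceil$, and $\xi_b(\theta,\rho)=(b-1)\sum_{n\ge1}s_n b^{-n}$, $\xi'_b(\theta,\rho)=(b-1)\sum_{n\ge1}s'_nb^{-n}$. Ostrowski expansion of reals: every $\sigma\in[-\theta,1-\theta]$ not in $\mathbb{Z}\theta+\mathbb{Z}$, or in $\mathbb{Z}_{\ge0}\theta+\mathbb{Z}$, is uniquely $\sigma=\sum_{k\ge1}\beta_k\theta_{k-1}$ with integers $0\le\beta_1\le a_1-1$, $0\le \beta_k\le a_k$, $\beta_k=0$ whenever $\beta_{k+1}=a_{k+1}$, and infinitely many odd and infinitely many even $k$ with $\beta_k<a_k$. Ostrowski expansion of an integer $N\ge0$: $N=\sum_{j\ge1}d_jq_{j-1}$ with $0\le d_1\le a_1-1$, $0\le d_j\le a_j$, $d_j=0$ whenever $d_{j+1}=a_{j+1}$. Digit sequence $(b_k)_{k\ge1}$ attached to $\xi$: (A) If $\rho\notin\mathbb{Z}\theta+\mathbb{Z}$ or $\rho\in\mathbb{Z}_{\ge1}\theta+\mathbb{Z}$, $(b_k)$ is the sequence of Ostrowski digits of $\rho-\theta$ (for both $\xi_b$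 and $\xi'_b$). (B) Otherwise $\rho-\theta=-m\theta+p$ with integers $m\ge1$, $p$. If $m=1$ (i.e. $\rho=0$), put $l=0$, $\beta=(a_1-1,0,a_3,0,a_5,0,\dots)$ and $\beta'=(0,a_2,0,a_4,0,\dots)$. If $m\ge2$, let $l\ge0$ be such that $q_l<m\le q_{l+1}$, let $q_{l+1}-m=\beta_1q_0+\cdots+\beta_{l+1}q_l$ be the Ostrowski expansion of the integer $q_{l+1}-m$, and set $\beta_{l+2j}=0$, $\beta_{l+2j+1}=a_{l+2j+1}$ for $j\ge1$; set $\beta'_i=\beta_i$ for $i\le l$, $\beta'_{l+1}=\beta_{l+1}+1$, $\beta'_{l+2}=a_{l+2}-1$, and $\beta'_{l+2j+1}=0$, $\beta'_{l+2j+2}=a_{l+2j+2}$ for $j\ge1$. Then for $\xi=\xi_b(\theta,\rho)$ take $(b_k)=\beta$ if $l$ is odd and $(b_k)=\beta'$ if $l$ is even; for $\xi=\xi'_b(\theta,\rho)$ take $(b_k)=\beta'$ if $l$ is odd and $(b_k)=\beta$ if $l$ is even. Put $t_0=0$, $r_0=1$, and for $k\ge1$, $t_k=b_1+b_2q_1+\cdots+b_kq_{k-1}$, $r_k=q_k-t_k$. For $k\ge0$ define $$c_k=b^{r_k+q_{k-1}}\frac{b^{(a_{k+1}-b_{k+1}-1)q_k}-1}{b^{q_k}-1},\quad d_k=b^{t_k}-1,\quad e_k=b^{r_k}-1,\quad f_k=b^{t_k}\frac{b^{b_{k+1}q_k}-1}{b^{q_k}-1}.$$ These are integers, which may be $0$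 or (for $c_k$) negative. $[0;A_1,A_2,\dots]$ denotes the regular continued fraction with partial quotients $A_j$. *)

theory Defs
  imports "HOL-Analysis.Analysis"
begin

text \<open>Sequences of partial quotients and of digits are indexed from 1; their value at 0 is
  irrelevant. The list \<open>[A\<^sub>1, \<dots>, A\<^sub>n]\<close> has the value \<open>[0; A\<^sub>1, \<dots>, A\<^sub>n]\<close>.\<close>

fun cfrac_list :: "real list \<Rightarrow> real" where
  "cfrac_list [] = 0"
| "cfrac_list (x # xs) = 1 / (x + cfrac_list xs)"

definition has_cfrac :: "real \<Rightarrow> (nat \<Rightarrow> real) \<Rightarrow> bool" where
  "has_cfrac x A \<longleftrightarrow>
     (\<forall>j\<ge>1. A j \<in> \<int> \<and> A j \<ge> 1) \<and>
     (\<lambda>n. cfrac_list (map A [1..<Suc n])) \<longlonglongrightarrow> x"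

text \<open>The index is shifted by one: \<open>cden a n\<close> and \<open>cnum a n\<close> are \<open>q\<^bsub>n-1\<^esub>\<close> and \<open>p\<^bsub>n-1\<^esub>\<close>.\<close>

fun cden :: "(nat \<Rightarrow> int) \<Rightarrow> nat \<Rightarrow> int" where
  "cden a 0 = 0"
| "cden a (Suc 0) = 1"
| "cden a (Suc (Suc n)) = a (Suc n) * cden a (Suc n) + cden a n"

fun cnum :: "(nat \<Rightarrow> int) \<Rightarrow> nat \<Rightarrow> int" where
  "cnum a 0 = 1"
| "cnum a (Suc 0) = 0"
| "cnum a (Suc (Suc n)) = a (Suc n) * cnum a (Suc n) + cnum a n"

abbreviation conv_q :: "(nat \<Rightarrow> int) \<Rightarrow> nat \<Rightarrow> int" where
  "conv_q a k \<equiv> cden a (Suc k)"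

abbreviation conv_p :: "(nat \<Rightarrow> int) \<Rightarrow> nat \<Rightarrow> int" where
  "conv_p a k \<equiv> cnum a (Suc k)"

definition theta_err :: "real \<Rightarrow> (nat \<Rightarrow> int) \<Rightarrow> nat \<Rightarrow> real" where
  "theta_err \<theta> a k = real_of_int (conv_q a k) * \<theta> - real_of_int (conv_p a k)"

definition sturm_floor :: "real \<Rightarrow> real \<Rightarrow> nat \<Rightarrow> int" where
  "sturm_floor \<theta> \<rho> n = \<lfloor>real n * \<theta> + \<rho>\<rfloor> - \<lfloor>(real n - 1) * \<theta> + \<rho>\<rfloor>"

definition sturm_ceil :: "real \<Rightarrow> real \<Rightarrow> nat \<Rightarrow> int" where
  "sturm_ceil \<theta> \<rho> n = \<lceil>real n * \<theta> + \<rho>\<rceil> - \<lceil>(real n - 1) * \<theta> + \<rho>\<rceil>"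

definition xi_floor :: "nat \<Rightarrow> real \<Rightarrow> real \<Rightarrow> real" where
  "xi_floor b \<theta> \<rho> =
     (real b - 1) * (\<Sum>n. real_of_int (sturm_floor \<theta> \<rho> (Suc n)) / real b ^ Suc n)"

definition xi_ceil :: "nat \<Rightarrow> real \<Rightarrow> real \<Rightarrow> real" where
  "xi_ceil b \<theta> \<rho> =
     (real b - 1) * (\<Sum>n. real_of_int (sturm_ceil \<theta> \<rho> (Suc n)) / real b ^ Suc n)"

definition ostrowski_real ::
  "real \<Rightarrow> (nat \<Rightarrow> int) \<Rightarrow> real \<Rightarrow> (nat \<Rightarrow> int) \<Rightarrow> bool" where
  "ostrowski_real \<theta> a \<sigma> \<beta> \<longleftrightarrow>
     (\<lambda>k. real_of_int (\<beta> (Suc k)) * theta_err \<theta> a k) sums \<sigma> \<and>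
     0 \<le> \<beta> 1 \<and> \<beta> 1 \<le> a 1 - 1 \<and>
     (\<forall>k\<ge>1. 0 \<le> \<beta> k \<and> \<beta> k \<le> a k) \<and>
     (\<forall>k\<ge>1. \<beta> (k + 1) = a (k + 1) \<longrightarrow> \<beta> k = 0) \<and>
     infinite {k. odd k \<and> \<beta> k < a k} \<and>
     infinite {k. even k \<and> \<beta> k < a k}"

text \<open>Ostrowski expansion of \<open>N\<close> whose digits vanish beyond position \<open>L\<close>; only the entries
  \<open>d\<^sub>1, \<dots>, d\<^sub>L\<close> of \<open>d\<close> are constrained.\<close>

definition ostrowski_int ::
  "(nat \<Rightarrow> int) \<Rightarrow> nat \<Rightarrow> int \<Rightarrow> (nat \<Rightarrow> int) \<Rightarrow> bool" where
  "ostrowski_int a L N d \<longleftrightarrow>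
     N = (\<Sum>j = 1..L. d j * conv_q a (j - 1)) \<and>
     0 \<le> d 1 \<and> d 1 \<le> a 1 - 1 \<and>
     (\<forall>j. 1 \<le> j \<and> j \<le> L \<longrightarrow> 0 \<le> d j \<and> d j \<le> a j) \<and>
     (\<forall>j. 1 \<le> j \<and> j < L \<longrightarrow> d (j + 1) = a (j + 1) \<longrightarrow> d j = 0)"

definition case_A :: "real \<Rightarrow> real \<Rightarrow> bool" where
  "case_A \<theta> \<rho> \<longleftrightarrow>
     \<not> (\<exists>m n :: int. \<rho> = real_of_int m * \<theta> + real_of_int n) \<or>
     (\<exists>m n :: int. m \<ge> 1 \<and> \<rho> = real_of_int m * \<theta> + real_of_int n)"

definition case_B_digits ::
  "(nat \<Rightarrow> int) \<Rightarrow> int \<Rightarrow> nat \<Rightarrow> (nat \<Rightarrow> int) \<Rightarrow> (nat \<Rightarrow> int) \<Rightarrow> bool" where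
  "case_B_digits a m l \<beta> \<beta>' \<longleftrightarrow>
     (m = 1 \<and> l = 0 \<and>
      (\<forall>k\<ge>1. \<beta> k = (if k = 1 then a 1 - 1 else if odd k then a k else 0)) \<and>
      (\<forall>k\<ge>1. \<beta>' k = (if even k then a k else 0)))
   \<or> (m \<ge> 2 \<and> conv_q a l < m \<and> m \<le> conv_q a (l + 1) \<and>
      ostrowski_int a (l + 1) (conv_q a (l + 1) - m) \<beta> \<and>
      (\<forall>j\<ge>1. \<beta> (l + 2 * j) = 0 \<and> \<beta> (l + 2 * j + 1) = a (l + 2 * j + 1)) \<and>
      (\<forall>i. 1 \<le> i \<and> i \<le> l \<longrightarrow> \<beta>' i = \<beta> i) \<and>
      \<beta>' (l + 1) = \<beta> (l + 1) + 1 \<and>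
      \<beta>' (l + 2) = a (l + 2) - 1 \<and>
      (\<forall>j\<ge>1. \<beta>' (l + 2 * j + 1) = 0 \<and> \<beta>' (l + 2 * j + 2) = a (l + 2 * j + 2)))"

definition digits_floor ::
  "real \<Rightarrow> (nat \<Rightarrow> int) \<Rightarrow> real \<Rightarrow> (nat \<Rightarrow> int) \<Rightarrow> bool" where
  "digits_floor \<theta> a \<rho> d \<longleftrightarrow>
     (if case_A \<theta> \<rho> then ostrowski_real \<theta> a (\<rho> - \<theta>) d
      else \<exists>(m::int) (p::int) l \<beta> \<beta>'. m \<ge> 1 \<and>
             \<rho> - \<theta> = - real_of_int m * \<theta> + real_of_int p \<and>
             case_B_digits a m l \<beta> \<beta>' \<and> d = (if odd l then \<beta> else \<beta>'))"

definition digits_ceil ::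
  "real \<Rightarrow> (nat \<Rightarrow> int) \<Rightarrow> real \<Rightarrow> (nat \<Rightarrow> int) \<Rightarrow> bool" where
  "digits_ceil \<theta> a \<rho> d \<longleftrightarrow>
     (if case_A \<theta> \<rho> then ostrowski_real \<theta> a (\<rho> - \<theta>) d
      else \<exists>(m::int) (p::int) l \<beta> \<beta>'. m \<ge> 1 \<and>
             \<rho> - \<theta> = - real_of_int m * \<theta> + real_of_int p \<and>
             case_B_digits a m l \<beta> \<beta>' \<and> d = (if odd l then \<beta>' else \<beta>))"

definition t_seq :: "(nat \<Rightarrow> int) \<Rightarrow> (nat \<Rightarrow> int) \<Rightarrow> nat \<Rightarrow> int" where
  "t_seq a \<beta> k = (\<Sum>j = 1..k. \<beta> j * conv_q a (j - 1))"

definition r_seq :: "(nat \<Rightarrow> int) \<Rightarrow> (nat \<Rightarrow> int) \<Rightarrow> nat \<Rightarrow> int" where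
  "r_seq a \<beta> k = conv_q a k - t_seq a \<beta> k"

text \<open>\<open>c\<close>, \<open>d\<close>, \<open>e\<close>, \<open>f\<close> are real-valued because the exponent
  \<open>(a\<^bsub>k+1\<^esub> - b\<^bsub>k+1\<^esub> - 1) q\<^sub>k\<close> can be negative; that the partial quotients are integers is
  part of \<^const>\<open>has_cfrac\<close>. In \<open>c_seq\<close>, \<open>cden a k\<close> is \<open>q\<^bsub>k-1\<^esub>\<close>.\<close>

definition c_seq :: "nat \<Rightarrow> (nat \<Rightarrow> int) \<Rightarrow> (nat \<Rightarrow> int) \<Rightarrow> nat \<Rightarrow> real" where
  "c_seq b a \<beta> k =
     real b powi (r_seq a \<beta> k + cden a k) *
     ((real b powi ((a (k + 1) - \<beta> (k + 1) - 1) * conv_q a k) - 1) /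
      (real b powi conv_q a k - 1))"

definition d_seq :: "nat \<Rightarrow> (nat \<Rightarrow> int) \<Rightarrow> (nat \<Rightarrow> int) \<Rightarrow> nat \<Rightarrow> real" where
  "d_seq b a \<beta> k = real b powi t_seq a \<beta> k - 1"

definition e_seq :: "nat \<Rightarrow> (nat \<Rightarrow> int) \<Rightarrow> (nat \<Rightarrow> int) \<Rightarrow> nat \<Rightarrow> real" where
  "e_seq b a \<beta> k = real b powi r_seq a \<beta> k - 1"

definition f_seq :: "nat \<Rightarrow> (nat \<Rightarrow> int) \<Rightarrow> (nat \<Rightarrow> int) \<Rightarrow> nat \<Rightarrow> real" where
  "f_seq b a \<beta> k =
     real b powi t_seq a \<beta> k *
     ((real b powi (\<beta> (k + 1) * conv_q a k) - 1) / (real b powi conv_q a k - 1))"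

text \<open>The sequence \<open>c\<^sub>0, d\<^sub>0, 1, e\<^sub>0, f\<^sub>0, c\<^sub>1, \<dots>\<close>, indexed from 0.\<close>

definition raw_seq :: "nat \<Rightarrow> (nat \<Rightarrow> int) \<Rightarrow> (nat \<Rightarrow> int) \<Rightarrow> nat \<Rightarrow> real" where
  "raw_seq b a \<beta> n =
     (let k = n div 5
      in [c_seq b a \<beta> k, d_seq b a \<beta> k, 1, e_seq b a \<beta> k, f_seq b a \<beta> k] ! (n mod 5))"

text \<open>Rule (i) as a scan from left to right. For \<open>S\<close> of the shape of \<^const>\<open>raw_seq\<close> the entry
  \<open>c\<^sub>k\<close> is \<open>S (5 * k)\<close>, so that a block to be replaced starts at \<open>i = 5 * k\<close> with
  \<open>S (i + 5) = c\<^bsub>k+1\<^esub> < 0\<close> and ends with \<open>S (i + 8) = e\<^bsub>k+1\<^esub>\<close>; \<open>rule_i_pos S n\<close> is the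
  position in \<open>S\<close> at which the part replaced by the \<open>n\<close>-th new entry begins. Two such blocks
  never overlap: \<open>c\<^bsub>k+1\<^esub> < 0\<close> means \<open>b\<^bsub>k+2\<^esub> = a\<^bsub>k+2\<^esub>\<close>, which forces
  \<open>b\<^bsub>k+1\<^esub> = 0 < a\<^bsub>k+1\<^esub>\<close>.\<close>

definition rule_i_block :: "(nat \<Rightarrow> real) \<Rightarrow> nat \<Rightarrow> bool" where
  "rule_i_block S i \<longleftrightarrow> 5 dvd i \<and> S (i + 5) < 0"

primrec rule_i_pos :: "(nat \<Rightarrow> real) \<Rightarrow> nat \<Rightarrow> nat" where
  "rule_i_pos S 0 = 0"
| "rule_i_pos S (Suc n) =
     rule_i_pos S n + (if rule_i_block S (rule_i_pos S n) then 9 else 1)"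

definition rule_i :: "(nat \<Rightarrow> real) \<Rightarrow> nat \<Rightarrow> real" where
  "rule_i S n =
     (let i = rule_i_pos S n
      in if rule_i_block S i then S i + 1 + S (i + 8) else S i)"

inductive zero_step :: "real list \<Rightarrow> real list \<Rightarrow> bool" where
  "zero_step (us @ [x, 0, y] @ vs) (us @ [x + y] @ vs)"

text \<open>\<open>A\<^sub>1, A\<^sub>2, \<dots>\<close> results from \<open>T 0, T 1, \<dots>\<close> by exhaustive use of \<open>x, 0, y \<mapsto> x + y\<close>:
  \<open>T\<close> splits into consecutive finite segments, finitely many replacements contract the segment
  number \<open>j\<close> to the single entry \<open>A\<^bsub>j+1\<^esub>\<close>, and no replacement applies to the result, i.e. it
  has no zero entry after its first one.\<close>

definition rule_ii :: "(nat \<Rightarrow> real) \<Rightarrow> (nat \<Rightarrow> real) \<Rightarrow> bool" where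
  "rule_ii T A \<longleftrightarrow>
     (\<exists>g :: nat \<Rightarrow> nat. g 0 = 0 \<and> strict_mono g \<and>
        (\<forall>j. zero_step\<^sup>*\<^sup>* (map T [g j..<g (Suc j)]) [A (Suc j)])) \<and>
     (\<forall>j\<ge>2. A j \<noteq> 0)"

end

theory Submission
  imports Defs
begin

text \<open>Put \<open>Q\<^sub>k = (b^q\<^sub>k - 1) / (b - 1)\<close>. Formally evaluating the unreduced sequence
  \<open>c\<^sub>0, d\<^sub>0, 1, e\<^sub>0, f\<^sub>0, c\<^sub>1, \<dots>\<close> as a continued fraction, the convergent that ends with
  \<open>f\<^bsub>k-1\<^esub>\<close> has denominator \<open>Q\<^sub>k\<close>, and its numerator \<open>P\<^sub>k\<close> satisfies
  \<open>P\<^bsub>k+1\<^esub> Q\<^sub>k - P\<^sub>k Q\<^bsub>k+1\<^esub> = (-1)^k b^t\<^bsub>k+1\<^esub>\<close>. On the other hand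
  \<open>b^t\<^bsub>k+1\<^esub> / ((b^q\<^sub>k - 1) (b^q\<^bsub>k+1\<^esub> - 1))\<close> is the generating function of the lattice
  points between the lines of slopes \<open>p\<^sub>k / q\<^sub>k\<close> and \<open>p\<^bsub>k+1\<^esub> / q\<^bsub>k+1\<^esub>\<close> through the point
  with abscissa \<open>- t\<^bsub>k+1\<^esub>\<close>, so \<open>P\<^sub>k / Q\<^sub>k\<close> is the number whose digits form the periodic
  word of slope \<open>p\<^sub>k / q\<^sub>k\<close> shifted by \<open>t\<^sub>k\<close>. These words stabilise to the Sturmian word,
  hence \<open>P\<^sub>k / Q\<^sub>k\<close> tends to \<open>\<xi>\<close>.

  Both rewriting rules are identities between products of the matrices attached to the partial
  quotients, so the convergents of the reduced sequence are among those of the unreduced one.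
  Two adjacent positive entries are never merged into the same partial quotient; therefore
  infinitely many convergents of the reduced sequence stop between \<open>1\<close> and \<open>e\<^sub>k\<close>, or between
  a block contracted by rule (i) and the next \<open>f\<^sub>k\<close>, and these lie within \<open>1 / Q\<^sub>k\<close> of
  \<open>P\<^sub>k / Q\<^sub>k\<close>.\<close>

subsection \<open>Continued fractions as state transformations\<close>

text \<open>The state is a pair of successive continuants: started at \<open>(0, 1)\<close> it
  carries numerators, at \<open>(1, 0)\<close> denominators. Unlike the nested fractions of
  \<open>cfrac_list\<close>, it stays meaningful for zero and negative entries.\<close>

definition cf_step :: "real \<Rightarrow> real \<times> real \<Rightarrow> real \<times> real" where
  "cf_step x s = (x * fst s + snd s, fst s)"

abbreviation cf_run :: "real list \<Rightarrow> real \<times> real \<Rightarrow> real \<times> real" where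
  "cf_run \<equiv> fold cf_step"

lemma cf_step_Pair [simp]: "cf_step x (u, v) = (x * u + v, u)"
  by (simp add: cf_step_def)

lemma cfrac_list_bounds:
  assumes "\<forall>x\<in>set xs. x \<ge> 1"
  shows "0 \<le> cfrac_list xs \<and> cfrac_list xs \<le> 1"
  using assms by (induction xs) auto

text \<open>Arbitrary start states keep the induction closed: absorbing the entry \<open>x\<close>
  multiplies numerator and denominator by the same positive number
  \<open>x + cfrac_list xs\<close>.\<close>

lemma cfrac_list_run:
  assumes "\<forall>x\<in>set xs. x \<ge> 1" "K > 0" "K' \<ge> 0"
  shows "(N + cfrac_list xs * N') / (K + cfrac_list xs * K') =
         fst (cf_run xs (N, N')) / fst (cf_run xs (K, K'))"
  using assms
proof (induction xs arbitrary: N N' K K')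
  case (Cons x xs)
  define c where "c = cfrac_list xs"
  have c: "0 \<le> c" using cfrac_list_bounds[of xs] Cons.prems by (auto simp: c_def)
  have x: "x \<ge> 1" using Cons.prems by auto
  have xc: "x + c > 0" using x c by linarith
  have "(N + cfrac_list (x # xs) * N') / (K + cfrac_list (x # xs) * K') =
        ((x + c) * (N + 1 / (x + c) * N')) / ((x + c) * (K + 1 / (x + c) * K'))"
    using xc by (simp add: c_def)
  also have "(x + c) * (N + 1 / (x + c) * N') = (x * N + N') + c * N"
    using xc by (simp add: field_simps)
  also have "(x + c) * (K + 1 / (x + c) * K') = (x * K + K') + c * K"
    using xc by (simp add: field_simps)
  also have "((x * N + N') + c * N) / ((x * K + K') + c * K) =
     fst (cf_run xs (x * N + N', N)) / fst (cf_run xs (x * K + K', K))"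
    unfolding c_def
  proof (rule Cons.IH)
    show "0 < x * K + K'" using x Cons.prems by (intro add_pos_nonneg) auto
  qed (use Cons.prems in auto)
  finally show ?case by simp
qed auto

lemma cfrac_list_eq_run:
  assumes "\<forall>x\<in>set xs. x \<ge> 1"
  shows "cfrac_list xs = fst (cf_run xs (0, 1)) / fst (cf_run xs (1, 0))"
  using cfrac_list_run[OF assms, of 1 0 0 1] by simp

text \<open>Every step is the matrix with rows \<open>(x, 1)\<close> and \<open>(1, 0)\<close>, of
  determinant -1.\<close>

lemma cf_run_det:
  "snd (cf_run xs (u, v)) * fst (cf_run xs (u', v')) - fst (cf_run xs (u, v)) * snd (cf_run xs (u', v')) =
   (-1) ^ length xs * (v * u' - u * v')"
proof (induction xs arbitrary: u v u' v')
  case (Cons x xs)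
  show ?case
    by (simp only: fold.simps comp_apply cf_step_Pair Cons.IH) (simp add: algebra_simps)
qed simp

lemma cf_run_pos:
  assumes "\<forall>x\<in>set xs. x \<ge> 0" "u > 0" "v > 0"
  shows "fst (cf_run xs (u, v)) > 0 \<and> snd (cf_run xs (u, v)) > 0"
  using assms
proof (induction xs arbitrary: u v)
  case (Cons x xs)
  have "x * u + v > 0" using Cons.prems by (simp add: add_nonneg_pos)
  then show ?case using Cons by simp
qed auto

text \<open>The start state \<open>(0, 1)\<close> has a vanishing component, so in the presence of
  zero entries only nonnegativity and a positive sum survive.\<close>

lemma cf_run_nonneg:
  assumes "\<forall>x\<in>set xs. x \<ge> 0" "u \<ge> 0" "v \<ge> 0" "u + v > 0"
  shows "fst (cf_run xs (u, v)) \<ge> 0 \<and> snd (cf_run xs (u, v)) \<ge> 0 \<and>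
         fst (cf_run xs (u, v)) + snd (cf_run xs (u, v)) > 0"
  using assms
proof (induction xs arbitrary: u v)
  case (Cons x xs)
  have "x * u \<ge> 0" using Cons.prems by simp
  then have "x * u + v \<ge> 0" "x * u + v + u > 0"
    using Cons.prems by linarith+
  then show ?case using Cons by auto
qed auto

text \<open>After the first entry the previous continuant is at least 1, so each further entry
  raises the denominator by at least 1.\<close>

lemma cf_run_den_ge:
  assumes "\<forall>x\<in>set xs. x \<ge> 1"
  shows "fst (cf_run xs (1, 0)) \<ge> 1 \<and> fst (cf_run xs (1, 0)) \<ge> length xs \<and>
         snd (cf_run xs (1, 0)) \<ge> 0 \<and>
         (xs \<noteq> [] \<longrightarrow> snd (cf_run xs (1, 0)) \<ge> 1)"
  using assms
proof (induction xs rule: rev_induct)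
  case (snoc x xs)
  obtain u v where uv: "cf_run xs (1, 0) = (u, v)" by fastforce
  have x: "x \<ge> 1" using snoc.prems by auto
  have IH: "u \<ge> 1" "u \<ge> length xs" "v \<ge> 0" "xs \<noteq> [] \<longrightarrow> v \<ge> 1"
    using snoc uv by auto
  have xu: "u \<le> x * u" using mult_right_mono[of 1 x u] x IH by simp
  have "x * u + v \<ge> 1" using xu IH by linarith
  moreover have "x * u + v \<ge> 1 + real (length xs)"
  proof (cases "xs = []")
    case True
    then have "real (length xs) = 0" by simp
    then show ?thesis using xu IH by linarith
  next
    case False
    then have "v \<ge> 1" using IH by blast
    then show ?thesis using xu IH by linarith
  qed
  ultimately show ?case using IH uv by (auto simp: add.commute)
qed auto

section \<open>Distances between convergents and a criterion for convergence\<close>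

abbreviation cf_conv :: "(nat \<Rightarrow> real) \<Rightarrow> nat \<Rightarrow> real" where
  "cf_conv A n \<equiv> cfrac_list (map A [1..<Suc n])"

text \<open>With the tail value \<open>c\<close> in [0, 1] the later convergent is
  \<open>(N + c * N') / (K + c * K')\<close>. As the determinant has absolute value 1, its distance
  to \<open>N / K\<close> is \<open>c / (K * (K + c * K'))\<close>.\<close>

lemma cf_conv_dist:
  assumes "\<And>j. j \<ge> 1 \<Longrightarrow> A j \<ge> 1" "n \<le> m"
  shows "\<bar>cf_conv A m - cf_conv A n\<bar> \<le> 1 / (fst (cf_run (map A [1..<Suc n]) (1, 0)))\<^sup>2"
proof -
  define xs where "xs = map A [1..<Suc n]"
  define ys where "ys = map A [Suc n..<Suc m]"
  have xy: "map A [1..<Suc m] = xs @ ys"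
    unfolding xs_def ys_def using assms(2)
    by (metis le_add_diff_inverse map_append plus_1_eq_Suc upt_add_eq_append
        Suc_le_mono le_add1)
  have xs1: "\<forall>x\<in>set xs. x \<ge> 1" and ys1: "\<forall>x\<in>set ys. x \<ge> 1"
    using assms by (auto simp: xs_def ys_def)
  obtain N N' where N: "cf_run xs (0, 1) = (N, N')" by fastforce
  obtain K K' where K: "cf_run xs (1, 0) = (K, K')" by fastforce
  have K1: "K \<ge> 1" "K' \<ge> 0" using cf_run_den_ge[OF xs1] K by auto
  define c where "c = cfrac_list ys"
  have c: "0 \<le> c" "c \<le> 1" using cfrac_list_bounds[OF ys1] by (auto simp: c_def)
  have cm: "cf_conv A m = (N + c * N') / (K + c * K')"
  proof -
    have "\<forall>x\<in>set (xs @ ys). x \<ge> 1" using xs1 ys1 by auto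
    from cfrac_list_eq_run[OF this] show ?thesis
      using cfrac_list_run[OF ys1, of K K' N N'] K1 N K by (simp only: xy c_def) simp
  qed
  have cn: "cf_conv A n = N / K"
    using cfrac_list_eq_run[OF xs1] N K by (simp add: xs_def)
  have det: "\<bar>N' * K - N * K'\<bar> = 1"
    using cf_run_det[of xs 0 1 1 0] N K by (simp add: power_abs)
  have Kc: "K + c * K' \<ge> K" "K + c * K' > 0" using c K1 by (auto intro: add_pos_nonneg)
  have "cf_conv A m - cf_conv A n = c * (N' * K - N * K') / (K * (K + c * K'))"
    using Kc K1 unfolding cm cn by (simp add: field_simps)
  then have "\<bar>cf_conv A m - cf_conv A n\<bar> = c / (K * (K + c * K'))"
    using det c Kc K1 by (simp add: abs_mult)
  also have "\<dots> \<le> 1 / (K * K)"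
    using c Kc K1 by (intro frac_le mult_left_mono) auto
  finally show ?thesis using K by (simp add: xs_def power2_eq_square)
qed

text \<open>Later convergents stay within \<open>1 / real n\<close> of the \<open>n\<close>-th one,
  so coming close to \<open>x\<close> infinitely often is enough. Only some convergents of a reduced
  sequence can be estimated directly.\<close>

lemma has_cfrac_subseq_limit:
  assumes A: "\<And>j. j \<ge> 1 \<Longrightarrow> A j \<in> \<int> \<and> A j \<ge> 1"
    and sub: "\<And>n \<epsilon>. \<epsilon> > 0 \<Longrightarrow> \<exists>m\<ge>n. \<bar>cf_conv A m - x\<bar> < \<epsilon>"
  shows "has_cfrac x A"
proof -
  have bnd: "\<bar>cf_conv A n - x\<bar> \<le> 1 / real n" if n: "n \<ge> 1" for n
  proof (rule field_le_epsilon)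
    fix \<epsilon> :: real assume "\<epsilon> > 0"
    then obtain m where m: "m \<ge> n" "\<bar>cf_conv A m - x\<bar> < \<epsilon>" using sub by blast
    define K where "K = fst (cf_run (map A [1..<Suc n]) (1, 0))"
    have K: "K \<ge> 1" "K \<ge> real n"
      using cf_run_den_ge[of "map A [1..<Suc n]"] A by (auto simp: K_def simp del: upt_Suc)
    have "\<bar>cf_conv A m - cf_conv A n\<bar> \<le> 1 / K\<^sup>2"
      using cf_conv_dist[of A n m] A m unfolding K_def by blast
    also have "\<dots> \<le> 1 / real n"
      using K n mult_mono[of "real n" K 1 K] by (intro frac_le) (auto simp: power2_eq_square)
    finally show "\<bar>cf_conv A n - x\<bar> \<le> 1 / real n + \<epsilon>" using m by linarith
  qed
  have "(\<lambda>n. cf_conv A n) \<longlonglongrightarrow> x"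
  proof (rule Lim_null_comparison[where g = "\<lambda>n. 1 / real n", THEN LIM_zero_cancel])
    show "\<forall>\<^sub>F n in sequentially. norm (cf_conv A n - x) \<le> 1 / real n"
      using bnd by (intro eventually_sequentiallyI[of 1]) auto
  qed (simp add: lim_1_over_n)
  then show ?thesis using A by (simp add: has_cfrac_def)
qed

text \<open>The matrices of \<open>x\<close>, \<open>0\<close>, \<open>y\<close> multiply to the
  matrix of \<open>x + y\<close>.\<close>

lemma zero_step_run: "zero_step\<^sup>*\<^sup>* xs ys \<Longrightarrow> cf_run xs s = cf_run ys s"
proof (induction rule: rtranclp_induct)
  case (step ys zs)
  from step(2) have "cf_run ys s = cf_run zs s"
    by cases (simp add: cf_step_def algebra_simps)
  then show ?case using step by simp
qed simp

text \<open>Identifies the single entry to which a segment contracts: it can only be the sum of the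
  segment.\<close>

lemma zero_step_sum_list: "zero_step\<^sup>*\<^sup>* xs ys \<Longrightarrow> sum_list xs = sum_list ys"
proof (induction rule: rtranclp_induct)
  case (step ys zs)
  from step(2) have "sum_list ys = sum_list zs" by cases simp
  then show ?case using step by simp
qed simp

lemma zero_step_append: "zero_step\<^sup>*\<^sup>* xs ys \<Longrightarrow> zero_step\<^sup>*\<^sup>* (xs @ zs) (ys @ zs)"
proof (induction rule: rtranclp_induct)
  case (step ys ys')
  from step(2) have "zero_step (ys @ zs) (ys' @ zs)"
    by cases (metis append.assoc zero_step.intros)
  then show ?case using step by auto
qed simp

text \<open>A single entry sends \<open>(0, 1)\<close> to \<open>(1, 0)\<close>, and contractions do
  not change the run.\<close>

lemma not_zero_steps_singleton_if_snd_run_pos: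
  assumes "snd (cf_run xs (0, 1)) > 0"
  shows "\<not> zero_step\<^sup>*\<^sup>* xs [y]"
  using zero_step_run[of xs "[y]" "(0, 1)"] assms by auto

text \<open>After two adjacent positive entries both components of the state are positive, and
  nonnegative entries keep them so.\<close>

lemma not_zero_steps_singleton_if_adjacent_pos:
  assumes "\<forall>z\<in>set (us @ [x, y] @ vs). z \<ge> 0" "x > 0" "y > 0"
  shows "\<not> zero_step\<^sup>*\<^sup>* (us @ [x, y] @ vs) [w]"
proof (rule not_zero_steps_singleton_if_snd_run_pos)
  obtain u v where uv: "cf_run us (0, 1) = (u, v)" by fastforce
  have nn: "u \<ge> 0" "v \<ge> 0" "u + v > 0" using cf_run_nonneg[of us 0 1] uv assms by auto
  have xp: "x * u + v > 0"
  proof (cases "u = 0")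
    case False
    then have "x * u > 0" using assms nn by simp
    then show ?thesis using nn by linarith
  qed (use nn in auto)
  then have "y * (x * u + v) + u > 0" using assms nn by (simp add: add_pos_nonneg)
  then show "snd (cf_run (us @ [x, y] @ vs) (0, 1)) > 0"
    using cf_run_pos[of vs "y * (x * u + v) + u" "x * u + v"] uv xp assms by simp
qed

subsection \<open>The unreduced sequence\<close>

lemma powi_geometric_quotient:
  fixes q n :: int and b :: nat
  assumes "b \<ge> 2" "q \<ge> 1" "n \<ge> 0"
  shows "(real b powi (n * q) - 1) / (real b powi q - 1) = real (\<Sum>i<nat n. (b ^ nat q) ^ i)"
proof -
  define x where "x = real b powi q"
  have x: "x = real (b ^ nat q)" using assms by (simp add: x_def power_int_def)
  have "x > 1" unfolding x using assms by (simp add: one_less_power)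
  have "real b powi (n * q) = x ^ nat n"
    using assms by (simp add: x power_int_def nat_mult_distrib mult.commute flip: power_mult)
  then have "(real b powi (n * q) - 1) / (real b powi q - 1) = (x ^ nat n - 1) / (x - 1)"
    by (simp add: x_def)
  also have "\<dots> = (\<Sum>i<nat n. x ^ i)"
    using \<open>x > 1\<close> by (simp add: geometric_sum)
  finally show ?thesis by (simp add: x)
qed

text \<open>The passage of the denominators through one block of five entries. Here
  \<open>B\<close>, \<open>D\<close>, \<open>E\<close>, \<open>M\<close> stand for b to the powers
  q_k, t_k, r_k, q_(k-1), while \<open>F\<close> and \<open>C\<close> belong to the exponents
  b_(k+1) q_k and (a_(k+1) - b_(k+1) - 1) q_k, and \<open>y\<close> is b - 1.\<close>

lemma cf_run_block:
  assumes "D * E = B" "c * (B - 1) = E * M * (C - 1)" "f * (B - 1) = D * (F - 1)" "y \<noteq> 0"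
  shows "cf_run [c, D - 1, 1, E - 1, f] ((B - 1) / y, E * (M - 1) / y) =
         ((B * F * C * M - 1) / y, E * C * M * (B - 1) / y)"
proof -
  have c: "c * ((B - 1) / y) + E * (M - 1) / y = E * (M * C - 1) / y"
  proof -
    have "c * ((B - 1) / y) + E * (M - 1) / y = (c * (B - 1) + E * (M - 1)) / y"
      by (simp add: add_divide_distrib)
    then show ?thesis unfolding assms(2) by (simp add: algebra_simps)
  qed
  have eq1: "(D - 1) * (E * (M * C - 1) / y) + (B - 1) / y + E * (M * C - 1) / y = (B * M * C - 1) / y"
    using assms(1,4) by (simp add: field_simps flip: assms(1))
  have eq2: "(E - 1) * ((B * M * C - 1) / y) + ((D - 1) * (E * (M * C - 1) / y) + (B - 1) / y)
      = E * C * M * (B - 1) / y"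
    using assms(1,4) by (simp add: field_simps flip: assms(1))
  have "f * (E * C * M * (B - 1) / y) = E * C * M * (D * (F - 1)) / y"
    using assms(3) by (metis (no_types, opaque_lifting) mult.assoc mult.commute times_divide_eq_right)
  also have "\<dots> = B * C * M * (F - 1) / y" by (simp add: assms(1)[symmetric])
  finally have eq3: "f * (E * C * M * (B - 1) / y) + (B * M * C - 1) / y = (B * F * C * M - 1) / y"
    by (simp add: add_divide_distrib[symmetric] algebra_simps)
  show ?thesis
    by (simp only: fold.simps comp_apply id_apply cf_step_Pair c mult_1 eq1 eq2 eq3)
qed

text \<open>The coefficients are the same for numerators and denominators. The one of
  \<open>u\<close> cancels in a cross product; the one of \<open>v\<close>, which is
  \<open>D * F\<close>, becomes b to the power t_(k+1).\<close>

lemma cf_run_block_linear: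
  assumes "f * (D * E - 1) = D * (F - 1)"
  shows "fst (cf_run [c, D - 1, 1, E - 1, f] (u, v)) =
         (f * (E * (D * c + 1) - c) + D * c + 1) * u + D * F * v"
proof -
  have "fst (cf_run [c, D - 1, 1, E - 1, f] (u, v)) =
         (f * (E * (D * c + 1) - c) + D * c + 1) * u + (f * (D * E - 1) + D) * v"
    by (simp add: algebra_simps)
  then show ?thesis unfolding assms by (simp add: algebra_simps)
qed

text \<open>Rule (i) as a matrix identity, for the shape that nine entries take around a full
  digit.\<close>

lemma cf_run_negative_block:
  "cf_run [c, D - 1, 1, E - 1, 0, - E, D - 1, 1, E' - 1] s = cf_run [c + 1 + (E' - 1)] s"
  by (cases s) (simp add: algebra_simps)

text \<open>Only the local digit rules are required. The sequences of case (B) have full digits at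
  all sufficiently large indices of one parity, so they are no Ostrowski expansions of reals, but
  they obey these rules.\<close>

locale ostrowski_digits =
  fixes b :: nat and a \<beta> :: "nat \<Rightarrow> int"
  assumes b_ge_2: "b \<ge> 2"
    and a_pos: "k \<ge> 1 \<Longrightarrow> a k \<ge> 1"
    and digit_nonneg: "k \<ge> 1 \<Longrightarrow> 0 \<le> \<beta> k"
    and digit_le: "k \<ge> 1 \<Longrightarrow> \<beta> k \<le> a k"
    and digit_1: "\<beta> 1 < a 1"
    and digit_zero: "k \<ge> 1 \<Longrightarrow> \<beta> (Suc k) = a (Suc k) \<Longrightarrow> \<beta> k = 0"
begin

abbreviation "q \<equiv> conv_q a"
abbreviation "p \<equiv> conv_p a"
abbreviation "t \<equiv> t_seq a \<beta>"
abbreviation "r \<equiv> r_seq a \<beta>"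
abbreviation "c \<equiv> c_seq b a \<beta>"
abbreviation "d \<equiv> d_seq b a \<beta>"
abbreviation "e \<equiv> e_seq b a \<beta>"
abbreviation "f \<equiv> f_seq b a \<beta>"
abbreviation "raw \<equiv> raw_seq b a \<beta>"

section \<open>Denominators of convergents and partial digit sums\<close>

lemma cden_bounds: "cden a k \<ge> 0 \<and> q k \<ge> 1 \<and> q k \<ge> int k \<and> (k \<ge> 1 \<longrightarrow> cden a k \<ge> 1)"
proof (induction k)
  case (Suc k)
  have "a (Suc k) * q k \<ge> 1 * q k" using a_pos[of "Suc k"] Suc by (intro mult_right_mono) auto
  then have "q (Suc k) \<ge> q k + cden a k" by simp
  then show ?case using Suc by (cases "k = 0") (auto simp del: cden.simps(3))
qed auto

lemma q_pos: "q k > 0" and q_ge: "q k \<ge> int k" and cden_nonneg: "cden a k \<ge> 0"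
  using cden_bounds[of k] by auto

lemma q_mono: "q k \<le> q (Suc k)"
proof -
  have "a (Suc k) * q k \<ge> 1 * q k" using a_pos[of "Suc k"] q_pos[of k] by (intro mult_right_mono) auto
  then show ?thesis using cden_nonneg[of k] by simp
qed

lemma t_Suc: "t (Suc k) = t k + \<beta> (Suc k) * q k"
  by (simp add: t_seq_def)

lemma t_0: "t 0 = 0"
  by (simp add: t_seq_def)

lemma t_nonneg: "t k \<ge> 0"
proof (induction k)
  case (Suc k)
  then show ?case using digit_nonneg[of "Suc k"] q_pos[of k] by (simp add: t_Suc del: cden.simps)
qed (simp add: t_0)

text \<open>A full digit is preceded by the digit 0, so the induction then goes back two indices and
  uses the recursion for q_k; otherwise one index suffices.\<close>

lemma t_less: "t k < q k"
proof (induction k rule: less_induct)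
  case (less k)
  show ?case
  proof (cases k)
    case (Suc j)
    show ?thesis
    proof (cases "\<beta> k = a k")
      case True
      then obtain i where i: "j = Suc i" using Suc digit_1 by (cases j) auto
      then have "\<beta> j = 0" using digit_zero[of j] Suc True by simp
      then have "t k = t i + a k * q j" using Suc i True t_Suc[of i] t_Suc[of j] by simp
      also have "\<dots> < q i + a k * q j" using less[of i] Suc i by simp
      also have "q i + a k * q j = q k" using Suc i by simp
      finally show ?thesis .
    next
      case False
      then have "\<beta> k + 1 \<le> a k" using digit_le[of k] Suc by simp
      then have "(\<beta> k + 1) * q j \<le> a k * q j" using q_pos[of j] by (intro mult_right_mono) auto
      moreover have "t j < q j" using less[of j] Suc by simp
      ultimately show ?thesis using Suc t_Suc[of j] cden_nonneg[of j] by (simp add: algebra_simps)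
    qed
  qed (simp add: t_0)
qed

lemma r_pos: "r k > 0"
  using t_less[of k] by (simp add: r_seq_def)

lemma r_Suc: "r (Suc k) = r k + (a (Suc k) - \<beta> (Suc k) - 1) * q k + cden a k"
  by (simp add: r_seq_def t_Suc algebra_simps)

lemma b_pos: "real b > 0" "real b \<noteq> 0" "real b > 1" "real b - 1 > 0"
  using b_ge_2 by auto

section \<open>Powers of the base and the formal denominators\<close>

definition pw :: "int \<Rightarrow> real" where "pw n = real b powi n"

lemma pw_add: "pw (m + n) = pw m * pw n"
  using b_pos by (simp add: pw_def power_int_add)

lemma pw_pos: "pw n > 0"
  using b_pos by (simp add: pw_def)

lemma pw_0 [simp]: "pw 0 = 1" by (simp add: pw_def)

lemma pw_1 [simp]: "pw 1 = real b" by (simp add: pw_def)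

lemma pw_mono: "m \<le> n \<Longrightarrow> pw m \<le> pw n"
  using b_pos by (simp add: pw_def power_int_increasing)

lemma pw_strict_mono: "m < n \<Longrightarrow> pw m < pw n"
  using b_pos by (simp add: pw_def power_int_strict_increasing)

lemma pw_gt_1: "n > 0 \<Longrightarrow> pw n > 1"
  using pw_strict_mono[of 0 n] by simp

lemma pw_int: "n \<ge> 0 \<Longrightarrow> pw n \<in> \<int>"
  by (simp add: pw_def power_int_def)

definition Q :: "nat \<Rightarrow> real" where "Q k = (pw (q k) - 1) / (real b - 1)"

text \<open>The second component of the denominator state after \<open>k\<close> blocks, that is,
  the denominator of the formal convergent that stops just before \<open>f (k - 1)\<close>. It
  vanishes for \<open>k = 0\<close>.\<close>

definition Q' :: "nat \<Rightarrow> real" where "Q' k = pw (r k) * (pw (cden a k) - 1) / (real b - 1)"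

lemma pw_le_quot: "n \<ge> 1 \<Longrightarrow> pw (n - 1) \<le> (pw n - 1) / (real b - 1)"
proof -
  assume n: "n \<ge> 1"
  have "pw n = pw (n - 1) * real b" using pw_add[of "n - 1" 1] by simp
  moreover have "pw (n - 1) \<ge> 1" using pw_mono[of 0 "n - 1"] n by simp
  ultimately show ?thesis using b_pos by (simp add: field_simps)
qed

lemma Q_ge: "pw (q k - 1) \<le> Q k"
  using pw_le_quot[of "q k"] q_pos[of k] unfolding Q_def by simp

lemma pw_t_le_Q: "pw (t k) \<le> Q k"
  using Q_ge[of k] pw_mono[of "t k" "q k - 1"] t_less[of k] by simp

lemma Q_pos: "Q k > 0"
  using Q_ge[of k] pw_pos[of "q k - 1"] by linarith

lemma Q_tendsto: "filterlim Q at_top sequentially"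
proof (rule filterlim_at_top_mono)
  show "filterlim real at_top sequentially" by (rule filterlim_real_sequentially)
  have "real k \<le> Q k" for k
  proof (cases k)
    case (Suc j)
    have "real (Suc j) \<le> real b ^ j"
    proof (induction j)
      case (Suc j)
      have "real (Suc (Suc j)) \<le> 2 * real (Suc j)" by simp
      also have "\<dots> \<le> real b * real b ^ j" using Suc b_ge_2 by (intro mult_mono) auto
      finally show ?case by simp
    qed simp
    also have "\<dots> = pw (int j)" by (simp add: pw_def)
    also have "\<dots> \<le> pw (q k - 1)" using q_ge[of k] Suc by (intro pw_mono) simp
    also have "\<dots> \<le> Q k" by (rule Q_ge)
    finally show ?thesis using Suc by simp
  qed (use Q_pos[of 0] in simp)
  then show "\<forall>\<^sub>F k in sequentially. real k \<le> Q k" by simp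
qed

lemma Q'_ge_1: "Q' (Suc k) \<ge> 1"
proof -
  have "pw (r (Suc k)) \<ge> 1" using pw_gt_1[OF r_pos[of "Suc k"]] by simp
  moreover have "Q k \<ge> 1" using pw_mono[of 0 "q k - 1"] Q_ge[of k] q_pos[of k] by simp
  moreover have "Q' (Suc k) = pw (r (Suc k)) * Q k" by (simp add: Q'_def Q_def)
  ultimately show ?thesis using mult_mono[of 1 "pw (r (Suc k))" 1 "Q k"] by simp
qed

section \<open>Integrality and signs of the entries\<close>

lemma c_eq: "c k * (pw (q k) - 1) =
    pw (r k) * pw (cden a k) * (pw ((a (Suc k) - \<beta> (Suc k) - 1) * q k) - 1)"
  using pw_gt_1[OF q_pos[of k]] b_pos
  by (simp add: c_seq_def pw_def power_int_add)

lemma f_eq: "f k * (pw (q k) - 1) = pw (t k) * (pw (\<beta> (Suc k) * q k) - 1)"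
  using pw_gt_1[OF q_pos[of k]] b_pos
  by (simp add: f_seq_def pw_def)

lemma d_eq: "d k = pw (t k) - 1" and e_eq: "e k = pw (r k) - 1"
  by (simp_all add: d_seq_def e_seq_def pw_def)

lemma pw_t_r: "pw (t k) * pw (r k) = pw (q k)"
  by (simp add: r_seq_def flip: pw_add)

lemma d_int: "d k \<in> \<int>" and d_nonneg: "d k \<ge> 0"
  using pw_int[OF t_nonneg[of k]] pw_mono[OF t_nonneg[of k]] by (auto simp: d_eq)

lemma e_int: "e k \<in> \<int>" and e_pos: "e k > 0"
  using pw_int[of "r k"] pw_gt_1[OF r_pos[of k]] r_pos[of k] by (auto simp: e_eq)

lemma f_alt: "f k = pw (t k) * real (\<Sum>i<nat (\<beta> (Suc k)). (b ^ nat (q k)) ^ i)"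
  using powi_geometric_quotient[of b "q k" "\<beta> (Suc k)"] b_ge_2 q_pos[of k] digit_nonneg[of "Suc k"]
  by (simp add: f_seq_def pw_def)

lemma f_int: "f k \<in> \<int>" and f_nonneg: "f k \<ge> 0"
  unfolding f_alt using pw_int[OF t_nonneg[of k]] pw_pos[of "t k"] by (auto simp del: of_nat_sum)

lemma geometric_sum_pos: "n > 0 \<Longrightarrow> real (\<Sum>i<nat n. (b ^ nat m) ^ i) > 0"
proof -
  assume "n > 0"
  then have "(\<Sum>i<nat n. (b ^ nat m) ^ i) \<ge> (b ^ nat m) ^ 0" by (intro member_le_sum) auto
  then show ?thesis by (simp del: of_nat_sum)
qed

lemma f_pos: "\<beta> (Suc k) > 0 \<Longrightarrow> f k > 0"
  unfolding f_alt using pw_pos[of "t k"] geometric_sum_pos[of "\<beta> (Suc k)" "q k"] by (intro mult_pos_pos)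

lemma c_alt:
  assumes "\<beta> (Suc k) < a (Suc k)"
  shows "c k = pw (r k + cden a k) *
           real (\<Sum>i<nat (a (Suc k) - \<beta> (Suc k) - 1). (b ^ nat (q k)) ^ i)"
  using powi_geometric_quotient[of b "q k" "a (Suc k) - \<beta> (Suc k) - 1"] b_ge_2 q_pos[of k] assms
  by (simp add: c_seq_def pw_def)

lemma c_int: "\<beta> (Suc k) < a (Suc k) \<Longrightarrow> c k \<in> \<int>"
  and c_nonneg: "\<beta> (Suc k) < a (Suc k) \<Longrightarrow> c k \<ge> 0"
  unfolding c_alt using pw_int[of "r k + cden a k"] pw_pos[of "r k + cden a k"] r_pos[of k] cden_nonneg[of k]
  by (auto simp del: of_nat_sum)

lemma c_pos: "a (Suc k) - \<beta> (Suc k) \<ge> 2 \<Longrightarrow> c k > 0"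
  using pw_pos[of "r k + cden a k"] geometric_sum_pos[of "a (Suc k) - \<beta> (Suc k) - 1" "q k"]
  by (subst c_alt) (auto intro!: mult_pos_pos)

text \<open>The quotient in \<open>c_seq\<close> has the form (1/B - 1) / (B - 1) = -1/B with B the
  power of b to q_(k+1). The preceding digit is 0, so t_(k+1) = t_k and the remaining exponent is
  r_k.\<close>

lemma c_full_digit:
  assumes "\<beta> (Suc (Suc k)) = a (Suc (Suc k))"
  shows "c (Suc k) = - pw (r k)"
proof -
  have b0: "\<beta> (Suc k) = 0" using digit_zero[of "Suc k"] assms by simp
  then have tt: "t (Suc k) = t k" by (simp add: t_Suc)
  have "c (Suc k) * (pw (q (Suc k)) - 1) = pw (r (Suc k)) * pw (q k) * (pw (- q (Suc k)) - 1)"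
    using c_eq[of "Suc k"] assms by simp
  also have "pw (r (Suc k)) * pw (q k) = pw (r k) * pw (q (Suc k))"
    using tt by (simp add: r_seq_def algebra_simps flip: pw_add del: cden.simps)
  also have "pw (r k) * pw (q (Suc k)) * (pw (- q (Suc k)) - 1) = - pw (r k) * (pw (q (Suc k)) - 1)"
    using pw_add[of "q (Suc k)" "- q (Suc k)"] by (simp add: algebra_simps del: cden.simps)
  finally show ?thesis
    using pw_gt_1[OF q_pos[of "Suc k"]] by (metis diff_gt_0_iff_gt less_irrefl mult_right_cancel)
qed

text \<open>Translates the trigger of rule (i) into digits. The first digit is never full, so a
  negative entry has an index of the form \<open>Suc j\<close>.\<close>

lemma c_neg_iff: "c k < 0 \<longleftrightarrow> \<beta> (Suc k) = a (Suc k)"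
proof
  assume "c k < 0"
  then show "\<beta> (Suc k) = a (Suc k)" using c_nonneg[of k] digit_le[of "Suc k"] by force
next
  assume *: "\<beta> (Suc k) = a (Suc k)"
  then obtain j where "k = Suc j" using digit_1 by (cases k) auto
  then show "c k < 0" using c_full_digit[of j] * pw_pos[of "r j"] by simp
qed

lemma c_0_nonneg: "c 0 \<ge> 0"
  using c_nonneg[of 0] digit_1 by simp

text \<open>A full digit is preceded by 0, which is not full since partial quotients are
  positive.\<close>

lemma c_neg_isolated: "c (Suc k) < 0 \<Longrightarrow> c k \<ge> 0"
  using digit_zero[of "Suc k"] a_pos[of "Suc k"] by (force simp: c_neg_iff intro: c_nonneg)

lemma raw_simps:
  "raw (5 * k) = c k" "raw (5 * k + 1) = d k" "raw (5 * k + 2) = 1"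
  "raw (5 * k + 3) = e k" "raw (5 * k + 4) = f k" "raw (5 * k + 5) = c (Suc k)"
proof -
  have *: "(5 * k + j) div 5 = k" "(5 * k + j) mod 5 = j" if "j < 5" for j :: nat
    using that by auto
  then have "raw (5 * k + j) = [c k, d k, 1, e k, f k] ! j" if "j < 5" for j
    using that by (simp add: raw_seq_def)
  from this[of 0] this[of 1] this[of 2] this[of 3] this[of 4]
  show "raw (5 * k) = c k" "raw (5 * k + 1) = d k" "raw (5 * k + 2) = 1"
    "raw (5 * k + 3) = e k" "raw (5 * k + 4) = f k" by simp_all
  have "(5 * k + 5) div 5 = Suc k" "(5 * k + 5) mod 5 = 0" by auto
  then show "raw (5 * k + 5) = c (Suc k)" by (simp add: raw_seq_def)
qed

lemma raw_block_upt: "map raw [0..<5 * k + 3] = map raw [0..<5 * k] @ [c k, d k, 1]"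
   "map raw [0..<5 * k + 4] = map raw [0..<5 * k] @ [c k, d k, 1, e k]"
   "map raw [0..<5 * Suc k] = map raw [0..<5 * k] @ [c k, d k, 1, e k, f k]"
   "map raw [5 * k..<5 * k + 9] = [c k, d k, 1, e k, f k, c (Suc k), d (Suc k), 1, e (Suc k)]"
proof -
  have *: "[m..<m + 3] = [m, m + 1, m + 2]" "[m..<m + 4] = [m, m + 1, m + 2, m + 3]"
    "[m..<m + 5] = [m, m + 1, m + 2, m + 3, m + 4]"
    "[m..<m + 9] = [m, m + 1, m + 2, m + 3, m + 4, m + 5, m + 5 + 1, m + 5 + 2, m + 5 + 3]" for m :: nat
    by (simp_all add: upt_rec)
  have u: "[0..<5 * k + j] = [0..<5 * k] @ [5 * k..<5 * k + j]" for j
    by (simp add: upt_add_eq_append[of 0])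
  show "map raw [0..<5 * k + 3] = map raw [0..<5 * k] @ [c k, d k, 1]"
   "map raw [0..<5 * k + 4] = map raw [0..<5 * k] @ [c k, d k, 1, e k]"
    unfolding u * by (simp_all only: map_append list.map raw_simps)
  have "5 * Suc k = 5 * k + 5" by simp
  then show "map raw [0..<5 * Suc k] = map raw [0..<5 * k] @ [c k, d k, 1, e k, f k]"
    by (simp only: u * map_append list.map raw_simps)
  have "5 * k + 5 = 5 * Suc k" by simp
  then show "map raw [5 * k..<5 * k + 9] = [c k, d k, 1, e k, f k, c (Suc k), d (Suc k), 1, e (Suc k)]"
    by (simp only: * list.map raw_simps)
qed

section \<open>Formal convergents of the unreduced sequence\<close>

definition P :: "nat \<Rightarrow> real" where "P k = fst (cf_run (map raw [0..<5 * k]) (0, 1))"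
definition P' :: "nat \<Rightarrow> real" where "P' k = snd (cf_run (map raw [0..<5 * k]) (0, 1))"

lemma run_num: "cf_run (map raw [0..<5 * k]) (0, 1) = (P k, P' k)"
  by (simp add: P_def P'_def)

lemma block_eq: "[c k, d k, 1, e k, f k] = [c k, pw (t k) - 1, 1, pw (r k) - 1, f k]"
  by (simp add: d_eq e_eq)

lemma pw_q_Suc: "pw (q (Suc k)) =
   pw (q k) * pw (\<beta> (Suc k) * q k) * pw ((a (Suc k) - \<beta> (Suc k) - 1) * q k) * pw (cden a k)"
  by (simp add: algebra_simps flip: pw_add)

lemma pw_r_Suc: "pw (r (Suc k)) =
   pw (r k) * pw ((a (Suc k) - \<beta> (Suc k) - 1) * q k) * pw (cden a k)"
  by (simp only: r_Suc pw_add)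

lemma run_den: "cf_run (map raw [0..<5 * k]) (1, 0) = (Q k, Q' k)"
proof (induction k)
  case 0
  then show ?case using b_pos by (simp add: Q_def Q'_def)
next
  case (Suc k)
  have "cf_run (map raw [0..<5 * Suc k]) (1, 0) =
        cf_run [c k, pw (t k) - 1, 1, pw (r k) - 1, f k] (Q k, Q' k)"
    unfolding raw_block_upt(3) by (simp only: fold_append comp_apply Suc block_eq)
  also have "\<dots> = (Q (Suc k), Q' (Suc k))"
    unfolding Q_def Q'_def pw_q_Suc pw_r_Suc
    by (rule cf_run_block[OF pw_t_r c_eq f_eq]) (use b_pos in simp)
  finally show ?case .
qed

lemma run_det: "P' k * Q k - P k * Q' k = (-1) ^ k"
proof -
  \<comment> \<open>A block has five entries, an odd number, so \<open>k\<close> blocks contribute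
    the sign of \<open>k\<close> steps.\<close>
  have "(-1 :: real) ^ (5 * k) = (-1) ^ k" by (cases "even k") simp_all
  then show ?thesis
    using cf_run_det[of "map raw [0..<5 * k]" 0 1 1 0] by (simp add: run_num run_den)
qed

lemma P_0: "P 0 = 0"
  by (simp add: P_def)

text \<open>Numerators and denominators pass the block with equal coefficients, so the cross product
  is the determinant of the previous state times the coefficient of its second component.\<close>

lemma P_diff: "P (Suc k) / Q (Suc k) - P k / Q k = (-1) ^ k * pw (t (Suc k)) / (Q k * Q (Suc k))"
proof -
  have *: "f k * (pw (t k) * pw (r k) - 1) = pw (t k) * (pw (\<beta> (Suc k) * q k) - 1)"
    using f_eq[of k] by (simp add: pw_t_r)
  define A where "A = f k * (pw (r k) * (pw (t k) * c k + 1) - c k) + pw (t k) * c k + 1"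
  have tS: "pw (t (Suc k)) = pw (t k) * pw (\<beta> (Suc k) * q k)" by (simp add: t_Suc pw_add)
  have "P (Suc k) = A * P k + pw (t (Suc k)) * P' k"
    unfolding P_def[of "Suc k"] raw_block_upt(3) A_def tS fold_append comp_apply run_num block_eq
    by (rule cf_run_block_linear[OF *])
  moreover have "fst (cf_run (map raw [0..<5 * Suc k]) (1, 0)) = A * Q k + pw (t (Suc k)) * Q' k"
    unfolding raw_block_upt(3) A_def tS fold_append comp_apply run_den block_eq
    by (rule cf_run_block_linear[OF *])
  then have "Q (Suc k) = A * Q k + pw (t (Suc k)) * Q' k" by (simp only: run_den fst_conv)
  ultimately have "P (Suc k) * Q k - P k * Q (Suc k) = pw (t (Suc k)) * (P' k * Q k - P k * Q' k)"
    by (simp add: algebra_simps)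
  also have "\<dots> = (-1) ^ k * pw (t (Suc k))" by (simp add: run_det)
  finally show ?thesis using Q_pos[of k] Q_pos[of "Suc k"] by (simp add: field_simps)
qed

text \<open>The difference is b^t_k over \<open>Y * Q k\<close> in absolute value. A digit that is
  not full gives \<open>c k \<ge> 0\<close>, hence \<open>Y \<ge> Q k\<close>, and b^t_k is at most
  \<open>Q k\<close>.\<close>

lemma prefix_value_after_one:
  assumes "\<beta> (Suc k) < a (Suc k)"
  shows "\<bar>fst (cf_run (map raw [0..<5 * k + 3]) (0, 1)) / fst (cf_run (map raw [0..<5 * k + 3]) (1, 0))
           - P k / Q k\<bar> \<le> 1 / Q k"
proof -
  define Y where "Y = pw (t k) * (c k * Q k + Q' k) + Q k"
  define Z where "Z = pw (t k) * (c k * P k + P' k) + P k"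
  have Z: "fst (cf_run (map raw [0..<5 * k + 3]) (0, 1)) = Z"
    unfolding raw_block_upt fold_append comp_apply run_num by (simp add: Z_def d_eq algebra_simps)
  have Y: "fst (cf_run (map raw [0..<5 * k + 3]) (1, 0)) = Y"
    unfolding raw_block_upt fold_append comp_apply run_den by (simp add: Y_def d_eq algebra_simps)
  have Qp: "Q k > 0" by (rule Q_pos)
  have "Q' k \<ge> 0"
    unfolding Q'_def using pw_pos[of "r k"] pw_mono[OF cden_nonneg[of k]] b_pos by auto
  then have YQ: "Y \<ge> Q k"
    using c_nonneg[OF assms] Qp pw_pos[of "t k"] by (simp add: Y_def)
  have "Z * Q k - P k * Y = pw (t k) * (P' k * Q k - P k * Q' k)"
    by (simp add: Z_def Y_def algebra_simps)
  then have "Z / Y - P k / Q k = pw (t k) * (-1) ^ k / (Y * Q k)"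
    using run_det[of k] YQ Qp by (simp add: diff_frac_eq mult.commute)
  then have "\<bar>Z / Y - P k / Q k\<bar> = pw (t k) / (Y * Q k)"
    using YQ Qp pw_pos[of "t k"] by (simp add: abs_mult power_abs)
  also have "\<dots> \<le> Q k / (Q k * Q k)"
    using YQ Qp pw_t_le_Q[of k] by (intro frac_le mult_mono) auto
  finally show ?thesis unfolding Y Z using Qp by simp
qed

text \<open>Reading \<open>f k\<close> moves the current continuant to the second component, so this
  prefix has the value \<open>P' (Suc k) / Q' (Suc k)\<close>. No sign of \<open>c k\<close> enters,
  as needed after a block contracted by rule (i).\<close>

lemma prefix_value_after_e:
  "\<bar>fst (cf_run (map raw [0..<5 * k + 4]) (0, 1)) / fst (cf_run (map raw [0..<5 * k + 4]) (1, 0))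
           - P (Suc k) / Q (Suc k)\<bar> \<le> 1 / Q (Suc k)"
proof -
  have *: "map raw [0..<5 * Suc k] = map raw [0..<5 * k + 4] @ [f k]"
    unfolding raw_block_upt by simp
  have "snd (cf_run (map raw [0..<5 * Suc k]) s) = fst (cf_run (map raw [0..<5 * k + 4]) s)" for s
    unfolding * by (simp add: cf_step_def)
  from this[of "(0,1)"] this[of "(1,0)"]
  have Z: "fst (cf_run (map raw [0..<5 * k + 4]) (0, 1)) = P' (Suc k)"
    and Y: "fst (cf_run (map raw [0..<5 * k + 4]) (1, 0)) = Q' (Suc k)"
    unfolding run_num run_den by simp_all
  have Qp: "Q (Suc k) > 0" by (rule Q_pos)
  have Q1: "Q' (Suc k) \<ge> 1" by (rule Q'_ge_1)
  have "P' (Suc k) / Q' (Suc k) - P (Suc k) / Q (Suc k) = (-1) ^ Suc k / (Q' (Suc k) * Q (Suc k))"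
    using run_det[of "Suc k"] Q1 Qp by (simp add: diff_frac_eq mult.commute)
  then have "\<bar>P' (Suc k) / Q' (Suc k) - P (Suc k) / Q (Suc k)\<bar> = 1 / (Q' (Suc k) * Q (Suc k))"
    using Q1 Qp by (simp add: abs_mult power_abs)
  also have "\<dots> \<le> 1 / (1 * Q (Suc k))"
    using Q1 Qp by (intro frac_le mult_mono) auto
  finally show ?thesis unfolding Y Z by simp
qed

lemma run_negative_block:
  assumes "c (Suc k) < 0"
  shows "cf_run (map raw [5 * k..<5 * k + 9]) s = cf_run [c k + 1 + e (Suc k)] s"
proof -
  have full: "\<beta> (Suc (Suc k)) = a (Suc (Suc k))" using assms by (simp add: c_neg_iff)
  then have b0: "\<beta> (Suc k) = 0" using digit_zero[of "Suc k"] by simp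
  have "d (Suc k) = pw (t k) - 1" "f k = 0"
    using b0 by (simp_all add: d_eq t_Suc f_alt)
  then show ?thesis
    unfolding raw_block_upt c_full_digit[OF full] by (simp only: d_eq[of k] e_eq cf_run_negative_block)
qed

end

subsection \<open>The rewriting rules\<close>

lemma upt_split: "i \<le> j \<Longrightarrow> j \<le> k \<Longrightarrow> [i..<k] = [i..<j] @ [j..<k]"
  using upt_add_eq_append[of i j "k - j"] by simp

text \<open>Greedy segmentation: a segment absorbs the next two entries as long as the first of them
  is 0. The second hypothesis makes every segment finite.\<close>

lemma rule_ii_exists:
  assumes nonneg: "\<And>i. T i \<ge> 0" and nz: "\<And>i. \<exists>m. T (i + 1 + 2 * m) \<noteq> 0"
  shows "\<exists>A. rule_ii T A"
proof -
  define len where "len i = (LEAST m. T (i + 1 + 2 * m) \<noteq> 0)" for i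
  define nxt where "nxt i = i + 1 + 2 * len i" for i
  define g where "g n = (nxt ^^ n) 0" for n
  define A where "A j = sum_list (map T [g (j - 1)..<g j])" for j
  have g_Suc: "g (Suc n) = nxt (g n)" for n by (simp add: g_def)
  have nxt_nz: "T (nxt i) \<noteq> 0" for i
    unfolding nxt_def len_def using LeastI_ex[OF nz[of i]] .
  have zeros: "T (i + 1 + 2 * m) = 0" if "m < len i" for i m
    using not_less_Least[of m "\<lambda>m. T (i + 1 + 2 * m) \<noteq> 0"] that by (auto simp: len_def)
  \<comment> \<open>Proved for every initial part of odd length, since the contraction proceeds from
    the left, one pair at a time.\<close>
  have red: "zero_step\<^sup>*\<^sup>* (map T [i..<i + 1 + 2 * m]) [sum_list (map T [i..<i + 1 + 2 * m])]"
    if "m \<le> len i" for i m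
    using that
  proof (induction m)
    case (Suc m)
    have z: "T (i + 1 + 2 * m) = 0" using zeros Suc.prems by simp
    define xs where "xs = map T [i..<i + 1 + 2 * m]"
    have e: "map T [i..<i + 1 + 2 * Suc m] = xs @ [0, T (i + 2 + 2 * m)]"
      using z by (simp add: xs_def)
    have "zero_step\<^sup>*\<^sup>* (xs @ [0, T (i + 2 + 2 * m)]) ([sum_list xs] @ [0, T (i + 2 + 2 * m)])"
      using Suc unfolding xs_def by (intro zero_step_append) simp
    moreover have "zero_step ([sum_list xs] @ [0, T (i + 2 + 2 * m)]) [sum_list xs + T (i + 2 + 2 * m)]"
      using zero_step.intros[of "[]" "sum_list xs" "T (i + 2 + 2 * m)" "[]"] by simp
    ultimately show ?case unfolding e by simp
  qed simp
  have "strict_mono g" by (rule strict_mono_Suc_iff[THEN iffD2]) (simp add: g_Suc nxt_def)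
  moreover have "zero_step\<^sup>*\<^sup>* (map T [g j..<g (Suc j)]) [A (Suc j)]" for j
    using red[of "len (g j)" "g j"] by (simp add: A_def g_Suc nxt_def)
  \<comment> \<open>All segments but the first start at a nonzero entry by the choice of
    \<open>nxt\<close>, so their sums are positive.\<close>
  moreover have "A j \<noteq> 0" if j: "j \<ge> 2" for j
  proof -
    obtain i where i: "j = Suc (Suc i)" using j by (metis add_2_eq_Suc le_Suc_ex)
    have "g (Suc i) < g (Suc (Suc i))" by (simp add: g_Suc[of "Suc i"] nxt_def)
    then have "A j = T (g (Suc i)) + sum_list (map T [Suc (g (Suc i))..<g (Suc (Suc i))])"
      by (simp add: A_def i upt_conv_Cons)
    moreover have "T (g (Suc i)) > 0"
      using nxt_nz[of "g i"] nonneg[of "g (Suc i)"] by (simp add: g_Suc)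
    moreover have "sum_list (map T [Suc (g (Suc i))..<g (Suc (Suc i))]) \<ge> 0"
      by (intro sum_list_nonneg) (auto simp: nonneg)
    ultimately show ?thesis by linarith
  qed
  moreover have "g 0 = 0" by (simp add: g_def)
  ultimately show ?thesis unfolding rule_ii_def by blast
qed

text \<open>Otherwise both entries lie in one segment, which then cannot contract to a single entry.
  This tells at which prefixes any result of rule (ii) must have a convergent.\<close>

lemma segment_boundary_between_pos:
  fixes g :: "nat \<Rightarrow> nat"
  assumes g: "g 0 = 0" "strict_mono g" and nonneg: "\<And>i. T i \<ge> 0"
    and steps: "\<And>j. zero_step\<^sup>*\<^sup>* (map T [g j..<g (Suc j)]) [A (Suc j)]"
    and pos: "T i > 0" "T (Suc i) > 0"
  shows "\<exists>n. g n = Suc i"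
proof (rule ccontr)
  assume no: "\<nexists>n. g n = Suc i"
  define n where "n = (LEAST n. i < g (Suc n))"
  have "i < g (Suc i)" using strict_mono_imp_increasing[OF g(2), of "Suc i"] by simp
  then have up: "i < g (Suc n)" unfolding n_def by (rule LeastI)
  have lo: "g n \<le> i"
  proof (cases n)
    case (Suc m)
    then show ?thesis using not_less_Least[of m "\<lambda>n. i < g (Suc n)"] by (simp add: n_def)
  qed (use g in simp)
  have up': "Suc i < g (Suc n)" using up no by (metis Suc_lessI)
  have "[g n..<g (Suc n)] = [g n..<i] @ [i, Suc i] @ [Suc (Suc i)..<g (Suc n)]"
    using upt_split[OF lo, of "g (Suc n)"] up up' by (simp add: upt_conv_Cons)
  then have "map T [g n..<g (Suc n)] = map T [g n..<i] @ [T i, T (Suc i)] @ map T [Suc (Suc i)..<g (Suc n)]"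
    by simp
  then show False
    using not_zero_steps_singleton_if_adjacent_pos[of "map T [g n..<i]" "T i" "T (Suc i)"
        "map T [Suc (Suc i)..<g (Suc n)]" "A (Suc n)"] steps[of n] pos nonneg by auto
qed

section \<open>The scan of rule (i) and the expansions obtained from it\<close>

context ostrowski_digits begin

abbreviation "T \<equiv> rule_i raw"
abbreviation "pos \<equiv> rule_i_pos raw"

lemma block_iff: "rule_i_block raw (5 * k) \<longleftrightarrow> c (Suc k) < 0"
  by (simp add: rule_i_block_def raw_simps)

lemma not_block: "0 < j \<Longrightarrow> j < 5 \<Longrightarrow> \<not> rule_i_block raw (5 * k + j)"
  by (auto simp: rule_i_block_def dvd_add_right_iff dest: dvd_imp_le)

text \<open>The nine entries from \<open>5 * k\<close> on end with \<open>e (Suc k)\<close>, so the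
  scan resumes at \<open>f (Suc k)\<close>.\<close>

lemma T_block:
  assumes "pos n = 5 * k" "c (Suc k) < 0"
  shows "T n = c k + 1 + e (Suc k)" "pos (Suc n) = 5 * Suc k + 4"
proof -
  have "5 * k + 8 = 5 * Suc k + 3" by simp
  then have "raw (5 * k + 8) = e (Suc k)" by (simp only: raw_simps)
  then show "T n = c k + 1 + e (Suc k)" "pos (Suc n) = 5 * Suc k + 4"
    using assms by (simp_all add: rule_i_def block_iff raw_simps)
qed

lemma T_raw:
  assumes "pos n = 5 * k + j" "j < 5" "j = 0 \<Longrightarrow> c (Suc k) \<ge> 0"
  shows "T n = raw (5 * k + j)" "pos (Suc n) = 5 * k + Suc j"
proof -
  have "\<not> rule_i_block raw (5 * k + j)"
    using not_block[of j k] block_iff[of k] assms by (cases "j = 0") auto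
  then show "T n = raw (5 * k + j)" "pos (Suc n) = 5 * k + Suc j"
    using assms by (simp_all add: rule_i_def)
qed

text \<open>The scan never stands on a negative entry: at a block start \<open>c k\<close> is
  nonnegative, and inside a block the next \<open>c\<close> is. After a contraction this holds
  because negative entries are isolated.\<close>

lemma pos_invariant:
  "\<exists>k j. j < 5 \<and> pos n = 5 * k + j \<and> (if j = 0 then c k \<ge> 0 else c (Suc k) \<ge> 0)"
proof (induction n)
  case 0
  show ?case using c_0_nonneg by (intro exI[of _ 0]) auto
next
  case (Suc n)
  then obtain k j where kj: "j < 5" "pos n = 5 * k + j" "if j = 0 then c k \<ge> 0 else c (Suc k) \<ge> 0"
    by blast
  show ?case
  proof (cases "j = 0 \<and> c (Suc k) < 0")
    case True
    then have "c (Suc (Suc k)) \<ge> 0" using c_neg_isolated[of "Suc k"] by force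
    then show ?thesis using T_block(2)[of n k] True kj by (intro exI[of _ "Suc k"] exI[of _ 4]) auto
  next
    case False
    then have c1: "c (Suc k) \<ge> 0" and ps: "pos (Suc n) = 5 * k + Suc j"
      using T_raw(2)[of n k j] kj by (auto split: if_splits)
    show ?thesis
    proof (cases "j = 4")
      case True
      then show ?thesis using c1 ps by (intro exI[of _ "Suc k"] exI[of _ 0]) auto
    next
      case False
      then show ?thesis using c1 ps kj by (intro exI[of _ k] exI[of _ "Suc j"]) auto
    qed
  qed
qed

lemma c_int': "c k \<ge> 0 \<Longrightarrow> c k \<in> \<int>"
  using c_neg_iff[of k] digit_le[of "Suc k"] by (intro c_int) force

lemma raw_int_nonneg:
  assumes "j < 5" "j = 0 \<Longrightarrow> c k \<ge> 0"
  shows "raw (5 * k + j) \<in> \<int> \<and> raw (5 * k + j) \<ge> 0"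
proof -
  consider "j = 0" | "j = 1" | "j = 2" | "j = 3" | "j = 4" using assms(1) by linarith
  then show ?thesis
    using c_int'[of k] assms d_int d_nonneg e_int e_pos[of k] f_int f_nonneg raw_simps[of k]
    by cases auto
qed

lemma T_int_nonneg: "T n \<in> \<int> \<and> T n \<ge> 0"
proof -
  obtain k j where kj: "j < 5" "pos n = 5 * k + j" "if j = 0 then c k \<ge> 0 else c (Suc k) \<ge> 0"
    using pos_invariant by blast
  show ?thesis
  proof (cases "j = 0 \<and> c (Suc k) < 0")
    case True
    then show ?thesis
      using T_block(1)[of n k] kj c_int'[of k] e_int[of "Suc k"] e_pos[of "Suc k"] by auto
  next
    case False
    then show ?thesis using T_raw(1)[of n k j] raw_int_nonneg[of j k] kj by (auto split: if_splits)
  qed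
qed

text \<open>Rule (i) leaves the state unchanged at each boundary between new entries;
  \<open>pos n\<close> is the matching prefix length.\<close>

lemma run_T: "cf_run (map T [0..<n]) s = cf_run (map raw [0..<pos n]) s"
proof (induction n)
  case (Suc n)
  obtain k j where kj: "j < 5" "pos n = 5 * k + j" "if j = 0 then c k \<ge> 0 else c (Suc k) \<ge> 0"
    using pos_invariant by blast
  show ?case
  proof (cases "j = 0 \<and> c (Suc k) < 0")
    case True
    have "[0..<pos (Suc n)] = [0..<5 * k] @ [5 * k..<5 * k + 9]"
      using T_block(2)[of n k] True kj upt_add_eq_append[of 0 "5 * k" 9] by simp
    then show ?thesis
      using Suc True kj T_block(1)[of n k] run_negative_block[of k] by simp
  next
    case False
    then have "c (Suc k) \<ge> 0" using kj by (auto split: if_splits)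
    then show ?thesis using T_raw[of n k j] kj Suc by simp
  qed
qed simp

lemma strict_mono_pos: "strict_mono pos"
  by (rule strict_mono_Suc_iff[THEN iffD2]) simp

lemma pos_plus:
  assumes "pos n = 5 * k" "c (Suc k) \<ge> 0" "j \<le> 5"
  shows "pos (n + j) = 5 * k + j"
  using assms(3)
proof (induction j)
  case (Suc j)
  then show ?case using T_raw(2)[of "n + j" k j] assms by simp
qed (use assms in simp)

text \<open>If \<open>c j\<close> is negative, the contraction starting one block earlier swallows
  everything up to \<open>e j\<close>; then only \<open>f j\<close> precedes the next block.\<close>

lemma pos_hits: "c k \<ge> 0 \<Longrightarrow> \<exists>n. pos n = 5 * k"
proof (induction k rule: less_induct)
  case (less k)
  show ?case
  proof (cases k)
    case 0
    then show ?thesis by (intro exI[of _ 0]) simp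
  next
    case (Suc j)
    show ?thesis
    proof (cases "c j \<ge> 0")
      case True
      then obtain n where "pos n = 5 * j" using less Suc by blast
      then have "pos (n + 5) = 5 * k" using pos_plus[of n j 5] less Suc by simp
      then show ?thesis by blast
    next
      case False
      then obtain i where i: "j = Suc i" using c_0_nonneg by (cases j) auto
      then have ci: "c i \<ge> 0" using c_neg_isolated[of i] False by simp
      then obtain n where "pos n = 5 * i" using less.IH[of i] Suc i by auto
      then have "pos (Suc n) = 5 * j + 4" using T_block(2)[of n i] False i by simp
      then have "pos (Suc (Suc n)) = 5 * k" using T_raw(2)[of "Suc n" j 4] Suc by simp
      then show ?thesis by blast
    qed
  qed
qed

text \<open>Either a contracted block is followed by \<open>f\<close>, positive because the digit is
  full, or the entry 1 is followed by \<open>e\<close>. In both cases the prefix ending between the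
  two entries has a known distance to some \<open>P k / Q k\<close>.\<close>

lemma adjacent_pos:
  "\<exists>n k'. k' \<ge> k \<and> T n > 0 \<and> T (Suc n) > 0 \<and>
     (pos (Suc n) = 5 * k' + 3 \<and> \<beta> (Suc k') < a (Suc k') \<or> pos (Suc n) = 5 * k' + 4)"
proof -
  \<comment> \<open>Negative entries are isolated, so \<open>k\<close> or \<open>Suc k\<close> will
    do.\<close>
  obtain k1 where k1: "k1 \<ge> k" "c k1 \<ge> 0"
    using c_neg_isolated[of k] by (cases "c k \<ge> 0"; cases "c (Suc k) \<ge> 0") force+
  obtain n where n: "pos n = 5 * k1" using pos_hits[OF k1(2)] by blast
  show ?thesis
  proof (cases "c (Suc k1) < 0")
    case True
    note Tb = T_block[OF n True]
    have "\<beta> (Suc (Suc k1)) > 0" using True a_pos[of "Suc (Suc k1)"] by (simp add: c_neg_iff)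
    then have "T (Suc n) > 0" using T_raw(1)[of "Suc n" "Suc k1" 4] Tb f_pos[of "Suc k1"] raw_simps(5)[of "Suc k1"]
      by simp
    moreover have "T n > 0" using Tb k1 e_pos[of "Suc k1"] by simp
    ultimately show ?thesis using Tb k1 by (intro exI[of _ n] exI[of _ "Suc k1"]) auto
  next
    case False
    have ps: "pos (n + j) = 5 * k1 + j" if "j \<le> 5" for j using pos_plus[OF n] False that by simp
    have "T (n + 2) = 1" using T_raw(1)[OF ps[of 2]] raw_simps[of k1] by simp
    moreover have "T (n + 3) = e k1" using T_raw(1)[OF ps[of 3]] raw_simps[of k1] by simp
    moreover have "\<beta> (Suc k1) < a (Suc k1)"
      using k1(2) c_neg_iff[of k1] digit_le[of "Suc k1"] by force
    ultimately show ?thesis using ps[of 3] k1 e_pos[of k1]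
      by (intro exI[of _ "n + 2"] exI[of _ k1]) (auto simp: numeral_3_eq_3 numeral_2_eq_2)
  qed
qed

text \<open>Of two adjacent positive entries beyond \<open>i\<close>, one lies at odd distance from
  \<open>i\<close>.\<close>

lemma rule_ii_T_exists: "\<exists>A. rule_ii T A"
proof (rule rule_ii_exists)
  fix i
  obtain n k where nk: "k \<ge> pos (i + 2)" "T n > 0" "T (Suc n) > 0" "pos (Suc n) \<ge> 5 * k + 3"
    using adjacent_pos[of "pos (i + 2)"] by fastforce
  have "pos (i + 2) < pos (Suc n)" using nk by linarith
  then have "i + 2 < Suc n" using strict_mono_less[OF strict_mono_pos] by blast
  then have n: "n \<ge> i + 1" by simp
  show "\<exists>m. T (i + 1 + 2 * m) \<noteq> 0"
  proof (cases "even (n - (i + 1))")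
    case True
    then obtain m where "n - (i + 1) = 2 * m" by blast
    then have "n = i + 1 + 2 * m" using n by simp
    then show ?thesis using nk by (intro exI[of _ m]) auto
  next
    case False
    then have "even (Suc n - (i + 1))" using n by (simp add: Suc_diff_le)
    then obtain m where "Suc n - (i + 1) = 2 * m" by blast
    then have "Suc n = i + 1 + 2 * m" using n by simp
    then show ?thesis using nk by (intro exI[of _ m]) auto
  qed
qed (use T_int_nonneg in blast)

text \<open>Entries are sums of nonnegative integers, and \<open>rule_ii\<close> excludes 0 from the
  second one on. The first needs the shape of the beginning of \<open>T\<close>.\<close>

lemma rule_ii_ge_1:
  assumes "rule_ii T A" "j \<ge> 1"
  shows "A j \<in> \<int> \<and> A j \<ge> 1"
proof -
  obtain g where g: "g 0 = 0" "strict_mono g"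
    and steps: "\<And>j. zero_step\<^sup>*\<^sup>* (map T [g j..<g (Suc j)]) [A (Suc j)]"
    and nz: "\<And>j. j \<ge> 2 \<Longrightarrow> A j \<noteq> 0"
    using assms(1) unfolding rule_ii_def by blast
  have sum: "A (Suc i) = sum_list (map T [g i..<g (Suc i)])" for i
    using zero_step_sum_list[OF steps[of i]] by simp
  have int: "A (Suc i) \<in> \<int> \<and> A (Suc i) \<ge> 0" for i
    unfolding sum using T_int_nonneg by (auto intro!: sum_nonneg simp: interv_sum_list_conv_sum_set_nat)
  have "A 1 \<noteq> 0"
  proof
    \<comment> \<open>All entries of the first segment vanish. Then \<open>T\<close> starts with 0,
      0, 1, so that segment has length 1 or 2: length 2 does not contract to one entry, and length 1
      leaves a second segment that is just 0 or starts with 0, 1.\<close>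
    assume A1: "A 1 = 0"
    have g1: "g 1 > 0" using g strict_monoD[OF g(2), of 0 1] by simp
    have T0: "T i = 0" if "i < g 1" for i
      using sum[of 0] A1 g that T_int_nonneg
      by (auto simp: interv_sum_list_conv_sum_set_nat sum_nonneg_eq_0_iff)
    have c1: "c (Suc 0) \<ge> 0"
    proof (rule ccontr)
      assume "\<not> c (Suc 0) \<ge> 0"
      then have "T 0 > 0" using T_block(1)[of 0 0] c_0_nonneg e_pos[of "Suc 0"] by simp
      then show False using T0[OF g1] by simp
    qed
    have ps: "pos j = j" if "j \<le> 5" for j using pos_plus[of 0 0 j] c1 that by simp
    have T1: "T 1 = 0"
      using T_raw(1)[of 1 0 1] ps[of 1] raw_simps(2)[of 0] by (simp add: d_eq t_0)
    have T2: "T 2 = 1" using T_raw(1)[of 2 0 2] ps[of 2] raw_simps(3)[of 0] by simp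
    have g3: "g 1 \<le> 2" using T0[of 2] T2 by force
    show False
    proof (cases "g 1 = 2")
      case True
      then have "map T [g 0..<g (Suc 0)] = [T 0, 0]" using g T1 by (simp add: upt_rec numeral_2_eq_2)
      then show False
        using steps[of 0] not_zero_steps_singleton_if_snd_run_pos[of "[T 0, 0]"] by simp
    next
      case False
      then have g1': "g (Suc 0) = 1" using g1 g3 by simp
      have g2: "g 2 > 1" using strict_monoD[OF g(2), of 1 2] g1' by simp
      have "g 2 \<noteq> 2"
        using sum[of 1] nz[of 2] g1' T1 by (auto simp: numeral_2_eq_2)
      then have "[g (Suc 0)..<g (Suc (Suc 0))] = [1, 2] @ [3..<g 2]"
        using g2 g1' by (simp add: upt_conv_Cons numeral_2_eq_2 numeral_3_eq_3)
      then have seg: "map T [g (Suc 0)..<g (Suc (Suc 0))] = [0, 1] @ map T [3..<g 2]"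
        using T1 T2 by simp
      have "snd (cf_run ([0, 1] @ map T [3..<g 2]) (0, 1)) > 0"
        using cf_run_pos[of "map T [3..<g 2]" 1 1] T_int_nonneg by simp
      then show False
        using steps[of 1] not_zero_steps_singleton_if_snd_run_pos seg by (metis One_nat_def)
    qed
  qed
  then have "A j \<noteq> 0" using nz[of j] assms(2) by (cases "j = 1") auto
  moreover have "A j \<in> \<int> \<and> A j \<ge> 0" using int[of "j - 1"] assms(2) by simp
  ultimately show ?thesis by (auto elim!: Ints_cases)
qed

lemma rule_ii_has_cfrac:
  assumes lim: "(\<lambda>k. P k / Q k) \<longlonglongrightarrow> x" and A: "rule_ii T A"
  shows "has_cfrac x A"
proof (rule has_cfrac_subseq_limit)
  show "A j \<in> \<int> \<and> A j \<ge> 1" if "j \<ge> 1" for j using rule_ii_ge_1[OF A that] .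
  obtain g where g: "g 0 = 0" "strict_mono g"
    and steps: "\<And>j. zero_step\<^sup>*\<^sup>* (map T [g j..<g (Suc j)]) [A (Suc j)]"
    using A unfolding rule_ii_def by blast
  have run_A: "cf_run (map A [1..<Suc n]) s = cf_run (map raw [0..<pos (g n)]) s" for n s
  proof -
    have "cf_run (map A [1..<Suc n]) s = cf_run (map T [0..<g n]) s"
    proof (induction n)
      case (Suc n)
      have le: "g n \<le> g (Suc n)" using strict_monoD[OF g(2), of n "Suc n"] by simp
      have "cf_run (map A [1..<Suc (Suc n)]) s = cf_run [A (Suc n)] (cf_run (map T [0..<g n]) s)"
        using Suc by simp
      also have "\<dots> = cf_run (map T [g n..<g (Suc n)]) (cf_run (map T [0..<g n]) s)"
        using zero_step_run[OF steps] by metis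
      also have "\<dots> = cf_run (map T ([0..<g n] @ [g n..<g (Suc n)])) s" by simp
      also have "[0..<g n] @ [g n..<g (Suc n)] = [0..<g (Suc n)]"
        using upt_split[of 0 "g n" "g (Suc n)"] le by simp
      finally show ?case .
    qed (simp add: g)
    then show ?thesis by (simp add: run_T)
  qed
  have conv: "cf_conv A n = fst (cf_run (map raw [0..<pos (g n)]) (0, 1)) /
      fst (cf_run (map raw [0..<pos (g n)]) (1, 0))" for n
  proof -
    have "\<forall>x\<in>set (map A [1..<Suc n]). x \<ge> 1" using rule_ii_ge_1[OF A] by (auto simp del: upt_Suc)
    from cfrac_list_eq_run[OF this] show ?thesis by (simp only: run_A)
  qed
  fix n :: nat and \<epsilon> :: real assume eps: "\<epsilon> > 0"
  have "\<forall>\<^sub>F k in sequentially. dist (P k / Q k) x < \<epsilon> / 2"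
    using tendstoD[OF lim, of "\<epsilon> / 2"] eps by simp
  moreover have "\<forall>\<^sub>F k in sequentially. Q k > 2 / \<epsilon>"
    using Q_tendsto by (auto simp: filterlim_at_top_dense)
  ultimately obtain k0 where k0: "\<And>k. k \<ge> k0 \<Longrightarrow> dist (P k / Q k) x < \<epsilon> / 2 \<and> Q k > 2 / \<epsilon>"
    using eventually_conj unfolding eventually_sequentially by (metis (mono_tags, lifting) linorder_linear order_trans)
  have close: "\<bar>v - x\<bar> < \<epsilon>" if "\<bar>v - P k / Q k\<bar> \<le> 1 / Q k" "k \<ge> k0" for v k
  proof -
    have "1 / Q k < \<epsilon> / 2" using k0[OF that(2)] eps Q_pos[of k] by (simp add: field_simps)
    then show ?thesis using k0[OF that(2)] that(1) unfolding dist_real_def by linarith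
  qed
  \<comment> \<open>The bound serves twice: \<open>k \<ge> k0\<close> for the approximation, and
    \<open>5 * k\<close> beyond \<open>pos (g n)\<close> to force \<open>m \<ge> n\<close>.\<close>
  obtain i k where ik: "k \<ge> k0 + pos (g n)" "T i > 0" "T (Suc i) > 0"
     "pos (Suc i) = 5 * k + 3 \<and> \<beta> (Suc k) < a (Suc k) \<or> pos (Suc i) = 5 * k + 4"
    using adjacent_pos[of "k0 + pos (g n)"] by blast
  obtain m where m: "g m = Suc i"
    using segment_boundary_between_pos[OF g, of T A i] steps ik T_int_nonneg by blast
  have "pos (g n) < pos (g m)" using ik m by auto
  then have "m \<ge> n" using strict_mono_less[OF strict_mono_pos] strict_mono_less[OF g(2)] by simp
  moreover have "\<bar>cf_conv A m - x\<bar> < \<epsilon>"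
    using ik(4)
  proof (elim disjE conjE)
    assume "pos (Suc i) = 5 * k + 3" "\<beta> (Suc k) < a (Suc k)"
    then show ?thesis using close[OF prefix_value_after_one[of k]] ik conv[of m] m by simp
  next
    assume "pos (Suc i) = 5 * k + 4"
    then show ?thesis using close[OF prefix_value_after_e[of k]] ik conv[of m] m by simp
  qed
  ultimately show "\<exists>m\<ge>n. \<bar>cf_conv A m - x\<bar> < \<epsilon>" by blast
qed

text \<open>All entries are positive except \<open>d 0 = 0\<close>, so rule (i) does nothing and
  rule (ii) only merges \<open>c 0\<close>, 0, 1.\<close>

lemma rule_ii_generic:
  assumes gen: "\<And>k. k \<ge> 1 \<Longrightarrow> a k - \<beta> k \<ge> 2 \<and> \<beta> k \<ge> 1"
  shows "rule_ii T (\<lambda>j. if j = 1 then c 0 + 1 else raw (j + 1))"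
proof -
  have cp: "c k > 0" for k using c_pos[of k] gen[of "Suc k"] by simp
  have pos_id: "pos n = n" for n
  proof (induction n)
    case (Suc n)
    have "\<not> rule_i_block raw n"
      using cp by (auto simp: rule_i_block_def raw_simps less_le_not_le elim!: dvdE)
    then show ?case using Suc by simp
  qed simp
  have TR: "T n = raw n" for n
  proof -
    have "\<not> rule_i_block raw n"
      using cp by (auto simp: rule_i_block_def raw_simps less_le_not_le elim!: dvdE)
    then show ?thesis by (simp add: rule_i_def pos_id)
  qed
  have dp: "d k > 0" if "k \<ge> 1" for k
  proof -
    obtain i where i: "k = Suc i" using \<open>k \<ge> 1\<close> by (cases k) auto
    have "t k > 0"
      using t_nonneg[of i] q_pos[of i] gen[of k] i unfolding i t_Suc by (simp add: add_nonneg_pos)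
    then show ?thesis using pw_gt_1 by (simp add: d_eq)
  qed
  have rp: "raw n \<noteq> 0" if "n \<ge> 2" for n
  proof -
    define k j where "k = n div 5" and "j = n mod 5"
    have n: "n = 5 * k + j" and "j < 5" by (auto simp: k_def j_def)
    then consider "j = 0" | "j = 1" | "j = 2" | "j = 3" | "j = 4" by linarith
    then show ?thesis
    proof cases
      case 2
      then have "k \<ge> 1" using that n by presburger
      then show ?thesis using dp[of k] 2 raw_simps(2)[of k] n by simp
    qed (use raw_simps[of k] cp[of k] e_pos[of k] f_pos[of k] gen[of "Suc k"] n in auto)
  qed
  \<comment> \<open>The first segment has three entries, every later one a single entry.\<close>
  define g where "g n = (if n = 0 then 0 else n + 2)" for n :: nat
  have "strict_mono g" by (rule strict_mono_Suc_iff[THEN iffD2]) (simp add: g_def)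
  moreover have "zero_step\<^sup>*\<^sup>* (map T [g j..<g (Suc j)]) [if Suc j = 1 then c 0 + 1 else raw (Suc j + 1)]" for j
  proof (cases j)
    case 0
    have "map T [0..<3] = [c 0, 0, 1]"
      using raw_simps[of 0] by (simp add: upt_rec TR d_eq t_0 numeral_3_eq_3 numeral_2_eq_2)
    moreover have "zero_step [c 0, 0, 1] [c 0 + 1]" using zero_step.intros[of "[]" "c 0" 1 "[]"] by simp
    ultimately have "zero_step\<^sup>*\<^sup>* (map T [0..<3]) [c 0 + 1]" by (simp only: r_into_rtranclp)
    moreover have "g 0 = 0" "g (Suc 0) = 3" by (simp_all add: g_def)
    ultimately show ?thesis by (simp only: 0 One_nat_def simp_thms if_True)
  next
    case (Suc i)
    then show ?thesis by (simp add: g_def TR)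
  qed
  moreover have "(if j = 1 then c 0 + 1 else raw (j + 1)) \<noteq> 0" if "j \<ge> 2" for j
    using rp[of "j + 1"] that by simp
  ultimately show ?thesis unfolding rule_ii_def by (intro conjI exI[of _ g]) (auto simp: g_def)
qed

end

subsection \<open>Lattice points between consecutive convergents\<close>

lemma div_minus_one_diff:
  fixes z m :: int
  assumes "m > 0"
  shows "z div m - (z - 1) div m = (if m dvd z then 1 else 0)"
proof (cases "m dvd z")
  case True
  then obtain y where y: "z = m * y" by blast
  have "(z - 1) div m = y - 1"
    by (rule int_div_pos_eq[where r = "m - 1"]) (use y assms in \<open>auto simp: algebra_simps\<close>)
  then show ?thesis using y assms by simp
next
  case False
  then have "z mod m > 0" using assms by (simp add: dvd_eq_mod_eq_0 order_less_le)
  moreover have "z mod m < m" using assms by simp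
  ultimately have "(z - 1) div m = z div m"
    by (intro int_div_pos_eq[where r = "z mod m - 1"]) (simp, linarith+)
  then show ?thesis using False by simp
qed

text \<open>The number of integers strictly between \<open>N u / q\<close> and \<open>N u' / q'\<close>, provided that
  \<open>N > 0\<close> and \<open>u / q < u' / q'\<close>.\<close>

definition gap :: "int \<Rightarrow> int \<Rightarrow> int \<Rightarrow> int \<Rightarrow> int \<Rightarrow> int" where
  "gap u q u' q' N = (N * u' - 1) div q' - (N * u) div q"

text \<open>A fraction strictly between two Farey neighbours has denominator at least
  \<open>q + q'\<close>.\<close>

lemma gap_eq_0:
  assumes "u' * q - u * q' = 1" "q > 0" "q' > 0" "0 < N" "N < q + q'"
  shows "gap u q u' q' N = 0"
proof -
  define y where "y = (N * u) div q"
  have y1: "y * q \<le> N * u" and y2: "(y + 1) * q \<ge> N * u + 1"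
  proof -
    have "N * u = y * q + (N * u) mod q" by (simp add: y_def)
    moreover have "0 \<le> (N * u) mod q" "(N * u) mod q < q" using assms(2) by simp_all
    ultimately show "y * q \<le> N * u" "(y + 1) * q \<ge> N * u + 1"
      unfolding distrib_right by linarith+
  qed
  have N: "N = q * (N * u') - q' * (N * u)"
    using arg_cong[OF assms(1), of "\<lambda>z. N * z"] by (simp add: algebra_simps)
  have "y * q * q' \<le> N * u * q'" using y1 assms(3) by (intro mult_right_mono) auto
  then have "(y * q') * q < (N * u') * q" using N assms(4) by (simp add: algebra_simps)
  then have lo: "y * q' < N * u'" using assms(2) by (simp only: mult_less_cancel_right_pos)
  have hi: "N * u' \<le> (y + 1) * q'"
  proof (rule ccontr)
    assume "\<not> ?thesis"
    then have "q * (N * u') \<ge> q * ((y + 1) * q' + 1)" using assms(2) by (intro mult_left_mono) auto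
    moreover have "q' * ((y + 1) * q) \<ge> q' * (N * u + 1)" using y2 assms(3) by (intro mult_left_mono) auto
    ultimately show False using N assms(5) by (simp add: algebra_simps)
  qed
  have "(N * u' - 1) div q' = y"
    by (rule int_div_pos_eq[where r = "N * u' - 1 - q' * y"])
      (use lo hi assms(3) in \<open>auto simp: algebra_simps\<close>)
  then show ?thesis by (simp add: gap_def y_def)
qed

text \<open>Adding \<open>q\<close> moves the lower end by exactly \<open>u\<close>, while by
  unimodularity the upper quotient becomes \<open>(N * u') div q' + u\<close>, without the
  \<open>- 1\<close>. The count changes exactly when \<open>N * u' / q'\<close> is an
  integer.\<close>

lemma gap_shift:
  assumes "u' * q - u * q' = 1" "q > 0" "q' > 0"
  shows "gap u q u' q' (N + q) = gap u q u' q' N + (if q' dvd N then 1 else 0)"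
proof -
  have "(N + q) * u' - 1 = N * u' + u * q'" using assms(1) by (simp add: algebra_simps)
  then have "((N + q) * u' - 1) div q' = (N * u') div q' + u" using assms by simp
  moreover have "((N + q) * u) div q = (N * u) div q + u" using assms by (simp add: distrib_right)
  ultimately have "gap u q u' q' (N + q) = (N * u') div q' - (N * u) div q"
    by (simp add: gap_def)
  also have "\<dots> = gap u q u' q' N + (if q' dvd N * u' then 1 else 0)"
    using div_minus_one_diff[OF assms(3), of "N * u'"] by (simp add: gap_def)
  also have "q' dvd N * u' \<longleftrightarrow> q' dvd N"
  proof
    assume "q' dvd N * u'"
    then have "q' dvd N * u' * q - N * u * q'" by (intro dvd_diff) auto
    also have "N * u' * q - N * u * q' = N"
      using arg_cong[OF assms(1), of "\<lambda>z. N * z"] by (simp add: algebra_simps)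
    finally show "q' dvd N" .
  qed simp
  finally show ?thesis .
qed

text \<open>The floor of \<open>- z / m\<close> is minus the ceiling of \<open>z / m\<close>, which
  is \<open>(z - 1) div m + 1\<close>.\<close>

lemma minus_div_eq:
  fixes z m :: int
  assumes "m > 0"
  shows "(- z) div m = - ((z - 1) div m) - 1"
proof (rule int_div_pos_eq[where r = "m - 1 - (z - 1) mod m"])
  have "z - 1 = m * ((z - 1) div m) + (z - 1) mod m" by simp
  then show "- z = m * (- ((z - 1) div m) - 1) + (m - 1 - (z - 1) mod m)"
    by (simp add: algebra_simps)
  have "0 \<le> (z - 1) mod m" "(z - 1) mod m < m" using assms by simp_all
  then show "0 \<le> m - 1 - (z - 1) mod m" "m - 1 - (z - 1) mod m < m" by linarith+
qed

text \<open>The reflection of y to N - y exchanges the two ends. It reduces odd \<open>k\<close>,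
  where the convergents come in the opposite order, to even \<open>k\<close>.\<close>

lemma gap_reflect:
  assumes "q > 0" "q' > 0"
  shows "gap u q u' q' N = gap (q' - u') q' (q - u) q N"
proof -
  have "N * (q - u) - 1 = - (N * u + 1) + N * q" by (simp add: algebra_simps)
  then have "(N * (q - u) - 1) div q = (- (N * u + 1)) div q + N"
    using assms by (metis add.commute div_mult_self1 less_irrefl)
  also have "(- (N * u + 1)) div q = - ((N * u) div q) - 1"
    using minus_div_eq[OF assms(1), of "N * u + 1"] by simp
  finally have 1: "(N * (q - u) - 1) div q = N - 1 - (N * u) div q" by simp
  have "N * (q' - u') = - (N * u') + N * q'" by (simp add: algebra_simps)
  then have "(N * (q' - u')) div q' = (- (N * u')) div q' + N"
    using assms by (metis add.commute div_mult_self1 less_irrefl)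
  also have "(- (N * u')) div q' = - ((N * u' - 1) div q') - 1"
    using minus_div_eq[OF assms(2)] .
  finally show ?thesis using 1 by (simp add: gap_def)
qed

text \<open>The terms below \<open>q\<close> vanish, and shifting by \<open>q\<close> reproduces the
  series with factor \<open>x ^ q\<close> plus the geometric series over the \<open>n\<close> with
  \<open>q'\<close> dividing \<open>n + s\<close>. This is a linear equation for the sum.\<close>

lemma gap_generating_function:
  fixes x :: real and q q' s :: nat
  assumes uni: "u' * int q - u * int q' = 1" and q: "q > 0" "q' > 0" "s < q'"
    and x: "0 < x" "x < 1"
    and h: "h = (\<lambda>n. if n = 0 then 0 else real_of_int (gap u (int q) u' (int q') (int n + int s)) * x ^ n)"
    and sm: "summable h"
  shows "suminf h = x ^ q * x ^ (q' - s) / ((1 - x ^ q) * (1 - x ^ q'))"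
proof -
  define ind where "ind n = (if n \<ge> 1 \<and> q' dvd n + s then x ^ n else 0)" for n
  have xq: "x ^ q < 1" "x ^ q' < 1" using x q by (auto simp: power_less_one_iff)
  have ind: "ind sums (x ^ (q' - s) / (1 - x ^ q'))"
  proof -
    \<comment> \<open>Enumerates the positive \<open>n\<close> for which \<open>q'\<close> divides
      \<open>n + s\<close>.\<close>
    define r where "r j = (j + 1) * q' - s" for j
    have rs: "r j + s = (j + 1) * q'" for j using q by (simp add: r_def trans_less_add1 less_imp_le)
    have "strict_mono r"
      by (rule strict_mono_Suc_iff[THEN iffD2]) (use rs q in \<open>metis Suc_eq_plus1 add_less_cancel_right lessI mult_less_cancel2\<close>)
    moreover have "ind n = 0" if "n \<notin> range r" for n
    proof (rule ccontr)
      assume "ind n \<noteq> 0"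
      then have n: "n \<ge> 1" "q' dvd n + s" by (auto simp: ind_def split: if_splits)
      then obtain y where y: "n + s = q' * y" by blast
      then obtain j where "y = j + 1" using n by (cases y) auto
      then have "n = r j" using y rs[of j] by (simp add: mult.commute)
      then show False using that by blast
    qed
    moreover have "(\<lambda>j. ind (r j)) = (\<lambda>j. x ^ (q' - s) * (x ^ q') ^ j)"
    proof
      fix j
      have rj: "r j = (q' - s) + q' * j" using q by (simp add: r_def algebra_simps)
      then have "r j \<ge> 1" using q by simp
      moreover have "q' dvd r j + s" unfolding rs by simp
      ultimately have "ind (r j) = x ^ r j" by (simp add: ind_def)
      then show "ind (r j) = x ^ (q' - s) * (x ^ q') ^ j"
        by (simp only: rj power_add power_mult)
    qed
    moreover have "(\<lambda>j. x ^ (q' - s) * (x ^ q') ^ j) sums (x ^ (q' - s) * (1 / (1 - x ^ q')))"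
      using x xq by (intro sums_mult geometric_sums) auto
    ultimately show ?thesis using sums_mono_reindex[of r ind] by simp
  qed
  have h0: "h n = 0" if "n < q" for n
    using gap_eq_0[OF uni, of "int n + int s"] q that by (simp add: h)
  have hshift: "h (n + q) = x ^ q * h n + x ^ q * ind n" for n
  proof (cases "n = 0")
    case True
    then show ?thesis using gap_eq_0[OF uni, of "int q + int s"] q by (simp add: h ind_def)
  next
    case False
    have "int q' dvd int n + int s \<longleftrightarrow> q' dvd n + s" by (metis int_dvd_int_iff of_nat_add)
    then show ?thesis
      using gap_shift[OF uni, of "int n + int s"] q False
      by (simp add: h ind_def power_add algebra_simps)
  qed
  have "suminf h = (\<Sum>n. h (n + q)) + (\<Sum>n<q. h n)"
    by (rule suminf_split_initial_segment[OF sm])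
  also have "(\<Sum>n<q. h n) = 0" using h0 by simp
  also have "(\<Sum>n. h (n + q)) = x ^ q * suminf h + x ^ q * (x ^ (q' - s) / (1 - x ^ q'))"
    unfolding hshift
    by (rule sums_unique[symmetric], intro sums_add sums_mult summable_sums sm ind)
  finally have *: "suminf h = x ^ q * suminf h + x ^ q * (x ^ (q' - s) / (1 - x ^ q')) + 0" .
  have "suminf h * (1 - x ^ q) = suminf h - x ^ q * suminf h" by (simp add: algebra_simps)
  also have "\<dots> = x ^ q * (x ^ (q' - s) / (1 - x ^ q'))" using * by linarith
  finally have "suminf h = x ^ q * (x ^ (q' - s) / (1 - x ^ q')) / (1 - x ^ q)"
    using xq by (metis diff_gt_0_iff_gt less_irrefl nonzero_mult_div_cancel_right)
  then show ?thesis by (simp add: mult.commute)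
qed

section \<open>Rounded lines along the convergents and their stabilisation\<close>

context ostrowski_digits begin

text \<open>The companion of \<open>t\<close> with numerators: t_k times the slope, minus
  \<open>tp k\<close>, is the partial sum of the Ostrowski series.\<close>

definition tp :: "nat \<Rightarrow> int" where "tp k = (\<Sum>j = 1..k. \<beta> j * p (j - 1))"

text \<open>For even \<open>k\<close> this is \<open>\<lfloor>(n + t\<^sub>k) p\<^sub>k / q\<^sub>k\<rfloor> - tp k\<close>, for odd \<open>k\<close> it is
  \<open>\<lceil>(n + t\<^sub>k) p\<^sub>k / q\<^sub>k\<rceil> - 1 - tp k\<close>: the rounding follows the side on which
  \<open>p\<^sub>k / q\<^sub>k\<close> approximates the slope.\<close>

definition G :: "nat \<Rightarrow> int \<Rightarrow> int" where
  "G k n = ((n + t k) * p k - (if odd k then 1 else 0)) div q k - tp k"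

lemma tp_Suc: "tp (Suc k) = tp k + \<beta> (Suc k) * p k"
  by (simp add: tp_def)

lemma p_bounds: "0 \<le> p k \<and> p k \<le> q k"
proof -
  have "0 \<le> p k \<and> p k \<le> q k \<and> 0 \<le> p (Suc k) \<and> p (Suc k) \<le> q (Suc k)"
  proof (induction k)
    case 0
    then show ?case using a_pos[of "Suc 0"] by simp
  next
    case (Suc k)
    have *: "a (Suc (Suc k)) \<ge> 0" using a_pos[of "Suc (Suc k)"] by simp
    have "a (Suc (Suc k)) * p (Suc k) \<le> a (Suc (Suc k)) * q (Suc k)"
      using Suc * by (intro mult_left_mono) auto
    moreover have "0 \<le> a (Suc (Suc k)) * p (Suc k)" using Suc * by (intro mult_nonneg_nonneg) auto
    ultimately show ?case
      using Suc cnum.simps(3)[of a "Suc k"] cden.simps(3)[of a "Suc k"] by linarith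
  qed
  then show ?thesis by blast
qed

lemma unimodular: "p (Suc k) * q k - p k * q (Suc k) = (-1) ^ k"
  by (induction k) (simp_all add: algebra_simps)

lemma G_0: "G 0 n = 0"
  by (simp add: G_def tp_def)

text \<open>Passing to t_(k+1) adds a multiple of the period q_k, so \<open>G k\<close> and
  \<open>G (Suc k)\<close> can be compared at the same abscissa.\<close>

lemma G_eq_shift: "G k n = ((n + t (Suc k)) * p k - (if odd k then 1 else 0)) div q k - tp (Suc k)"
proof -
  have "(n + t (Suc k)) * p k - (if odd k then 1 else 0) =
        (n + t k) * p k - (if odd k then 1 else 0) + \<beta> (Suc k) * p k * q k"
    by (simp add: t_Suc algebra_simps)
  moreover have "q k \<noteq> 0" using q_pos[of k] by simp
  ultimately show ?thesis by (simp only: G_def tp_Suc div_mult_self1) simp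
qed

lemma G_diff:
  "\<exists>u u'. u' * q k - u * q (Suc k) = 1 \<and>
     (\<forall>n. G (Suc k) n - G k n = (-1) ^ k * gap u (q k) u' (q (Suc k)) (n + t (Suc k)))"
proof (cases "even k")
  case True
  have "p (Suc k) * q k - p k * q (Suc k) = 1" using unimodular[of k] True by simp
  moreover have "G (Suc k) n - G k n = (-1) ^ k * gap (p k) (q k) (p (Suc k)) (q (Suc k)) (n + t (Suc k))" for n
    unfolding G_eq_shift[of k] gap_def using True by (simp add: G_def del: cden.simps cnum.simps)
  ultimately show ?thesis by blast
next
  case False
  have "(q (Suc k) - p (Suc k)) * q k - (q k - p k) * q (Suc k) = 1"
    using unimodular[of k] False by (simp add: left_diff_distrib right_diff_distrib del: cden.simps cnum.simps)
  moreover have "G (Suc k) n - G k n =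
      (-1) ^ k * gap (q k - p k) (q k) (q (Suc k) - p (Suc k)) (q (Suc k)) (n + t (Suc k))" for n
    unfolding gap_reflect[OF q_pos q_pos, symmetric]
    unfolding G_eq_shift[of k] gap_def using False by (simp add: G_def del: cden.simps cnum.simps)
  ultimately show ?thesis by blast
qed

text \<open>Here n + t_(k+1) is positive and less than q_k + q_(k+1), so no lattice point lies in
  between.\<close>

lemma G_Suc_eq:
  assumes "1 \<le> n" "n \<le> q k"
  shows "G (Suc k) n = G k n"
proof -
  obtain u u' where u: "u' * q k - u * q (Suc k) = 1"
    "\<And>n. G (Suc k) n - G k n = (-1) ^ k * gap u (q k) u' (q (Suc k)) (n + t (Suc k))"
    using G_diff by blast
  have "gap u (q k) u' (q (Suc k)) (n + t (Suc k)) = 0"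
    using assms t_less[of "Suc k"] t_nonneg[of "Suc k"] by (intro gap_eq_0[OF u(1) q_pos q_pos]) linarith+
  then show ?thesis using u(2)[of n] by simp
qed

lemma G_stable:
  assumes "1 \<le> n" "n \<le> k"
  shows "G k (int n) = G n (int n)"
  using assms(2)
proof (induction k rule: dec_induct)
  case (step k)
  then show ?case using G_Suc_eq[of "int n" k] q_ge[of k] assms(1) by simp
qed simp

lemma G_1: "G k 1 = 0"
proof (induction k)
  case (Suc k)
  then show ?case using G_Suc_eq[of 1 k] q_pos[of k] by simp
qed (simp add: G_0)

lemma G_step: "0 \<le> G k (n + 1) - G k n \<and> G k (n + 1) - G k n \<le> 1"
proof -
  define z where "z = (n + t k) * p k - (if odd k then 1 else 0)"
  have e: "(n + 1 + t k) * p k - (if odd k then 1 else 0) = z + p k" by (simp add: z_def algebra_simps)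
  have "z div q k \<le> (z + p k) div q k" using p_bounds[of k] q_pos[of k] by (intro zdiv_mono1) auto
  moreover have "(z + p k) div q k \<le> (z + q k) div q k" using p_bounds[of k] q_pos[of k] by (intro zdiv_mono1) auto
  moreover have "(z + q k) div q k = z div q k + 1" using q_pos[of k] by simp
  ultimately show ?thesis unfolding G_def e z_def[symmetric] by linarith
qed

lemma G_bounds: "0 \<le> G k (int (Suc n)) \<and> G k (int (Suc n)) \<le> int n"
proof (induction n)
  case (Suc n)
  then show ?case using G_step[of k "int (Suc n)"] by (simp add: add.commute)
qed (simp add: G_1)

section \<open>Generating functions of the rounded lines\<close>

abbreviation "x \<equiv> 1 / real b"

lemma x_bounds: "0 < x" "x < 1"
  using b_pos by auto

definition Gs :: "nat \<Rightarrow> nat \<Rightarrow> real" where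
  "Gs k n = (if n = 0 then 0 else real_of_int (G k (int n)) * x ^ n)"

text \<open>The pointwise limit of \<open>Gs k\<close>: by \<open>G_stable\<close> the diagonal
  value is the common one for all indices from \<open>n\<close> on.\<close>

definition Gl :: "nat \<Rightarrow> real" where
  "Gl n = (if n = 0 then 0 else real_of_int (G n (int n)) * x ^ n)"

lemma summable_nx: "summable (\<lambda>n. real n * x ^ n)"
proof -
  have "summable (\<lambda>n. real (Suc n) * x ^ n)"
    using geometric_deriv_sums[of x] x_bounds by (auto simp: sums_iff)
  then show ?thesis
    by (rule summable_comparison_test'[where N = 0]) (use x_bounds in \<open>auto intro!: mult_right_mono\<close>)
qed

lemma Gs_bound: "norm (Gs k n) \<le> real n * x ^ n"
proof (cases n)
  case (Suc m)
  have "0 \<le> real_of_int (G k (int (Suc m)))" "real_of_int (G k (int (Suc m))) \<le> real (Suc m)"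
    using G_bounds[of k m] by linarith+
  then have "\<bar>real_of_int (G k (int n))\<bar> * x ^ n \<le> real n * x ^ n"
    using Suc x_bounds by (intro mult_right_mono) auto
  then show ?thesis using Suc x_bounds by (simp add: Gs_def abs_mult)
qed (simp add: Gs_def)

lemma summable_Gs: "summable (Gs k)"
  by (rule summable_comparison_test'[OF summable_nx, of 0]) (rule Gs_bound)

lemma pw_eq_x: "m \<ge> 0 \<Longrightarrow> pw m = 1 / x ^ nat m"
  by (simp add: pw_def power_int_def power_one_over)

text \<open>Both sides vanish for \<open>k = 0\<close> and have equal increments, by
  \<open>P_diff\<close> on the left and the lattice point count on the right.\<close>

lemma P_eq_suminf: "P k / Q k = (real b - 1)\<^sup>2 * suminf (Gs k)"
proof (induction k)
  case 0
  have "Gs 0 = (\<lambda>n. 0)" by (auto simp: Gs_def G_0)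
  then show ?case by (simp add: P_0)
next
  case (Suc k)
  obtain u u' where u: "u' * q k - u * q (Suc k) = 1"
    "\<And>n. G (Suc k) n - G k n = (-1) ^ k * gap u (q k) u' (q (Suc k)) (n + t (Suc k))"
    using G_diff by blast
  define m m' s where "m = nat (q k)" and "m' = nat (q (Suc k))" and "s = nat (t (Suc k))"
  have ints: "q k = int m" "q (Suc k) = int m'" "t (Suc k) = int s"
    using q_pos[of k] q_pos[of "Suc k"] t_nonneg[of "Suc k"]
    unfolding m_def m'_def s_def by (auto simp del: cden.simps)
  define h where "h = (\<lambda>n. if n = 0 then 0
     else real_of_int (gap u (int m) u' (int m') (int n + int s)) * x ^ n)"
  have Gd: "Gs (Suc k) n - Gs k n = (-1) ^ k * h n" for n
  proof (cases "n = 0")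
    case False
    have "real_of_int (G (Suc k) (int n)) - real_of_int (G k (int n)) =
        (-1) ^ k * real_of_int (gap u (int m) u' (int m') (int n + int s))"
      using arg_cong[OF u(2)[of "int n"], of real_of_int] unfolding ints by simp
    then show ?thesis using False by (simp add: Gs_def h_def left_diff_distrib[symmetric])
  qed (simp add: Gs_def h_def)
  have he: "h = (\<lambda>n. (-1) ^ k * (Gs (Suc k) n - Gs k n))"
    unfolding Gd by (simp add: power_mult_distrib[symmetric] flip: mult.assoc)
  have sm: "summable h"
    unfolding he by (intro summable_mult summable_diff summable_Gs)
  have ms: "m > 0" "m' > 0" "s < m'"
    using q_pos[of k] q_pos[of "Suc k"] t_less[of "Suc k"] unfolding ints by auto
  have sum: "suminf h = x ^ m * x ^ (m' - s) / ((1 - x ^ m) * (1 - x ^ m'))"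
    by (rule gap_generating_function[OF u(1)[unfolded ints] ms x_bounds h_def sm])
  have "suminf (Gs (Suc k)) - suminf (Gs k) = (-1) ^ k * suminf h"
    by (subst suminf_diff[OF summable_Gs summable_Gs]) (simp add: Gd suminf_mult[OF sm])
  also have "(real b - 1)\<^sup>2 * \<dots> = (-1) ^ k * pw (t (Suc k)) / (Q k * Q (Suc k))"
  proof -
    have xm: "x ^ m < 1" "x ^ m' < 1" "x ^ m > 0" "x ^ m' > 0" "x ^ s > 0"
      using x_bounds ms by (auto simp: power_less_one_iff simp del: power_one_over)
    have "x ^ m' = x ^ (m' - s) * x ^ s" using ms by (metis le_add_diff_inverse2 less_imp_le power_add)
    then have e1: "x ^ (m' - s) = x ^ m' / x ^ s"
      using xm(5) by (metis less_irrefl nonzero_mult_div_cancel_right)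
    have e2: "pw (t (Suc k)) = 1 / x ^ s" "pw (q k) = 1 / x ^ m" "pw (q (Suc k)) = 1 / x ^ m'"
      unfolding ints by (simp_all add: pw_eq_x)
    define X Y Z where "X = x ^ m" and "Y = x ^ m'" and "Z = x ^ s"
    define B where "B = real b - 1"
    have "B > 0" using b_pos by (simp add: B_def)
    moreover have "X < 1" "Y < 1" "X > 0" "Y > 0" "Z > 0" using xm by (simp_all add: X_def Y_def Z_def)
    ultimately show ?thesis
      unfolding sum Q_def e1 e2 X_def[symmetric] Y_def[symmetric] Z_def[symmetric] B_def[symmetric]
      by (simp add: field_simps power2_eq_square)
  qed
  finally show ?case using Suc P_diff[of k] by (simp add: algebra_simps)
qed

lemma P_limit: "(\<lambda>k. P k / Q k) \<longlonglongrightarrow> (real b - 1)\<^sup>2 * suminf Gl"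
  and summable_Gl: "summable Gl"
proof -
  have "(\<lambda>k. Gs k n) \<longlonglongrightarrow> Gl n" for n
  proof (rule tendsto_eventually)
    show "\<forall>\<^sub>F k in sequentially. Gs k n = Gl n"
    proof (rule eventually_sequentiallyI[of n])
      fix k assume "n \<le> k"
      then have "n \<ge> 1 \<Longrightarrow> G k (int n) = G n (int n)" using G_stable by blast
      then show "Gs k n = Gl n" by (cases "n = 0") (simp_all only: Gs_def Gl_def, simp_all)
    qed
  qed
  moreover have "\<forall>\<^sub>F (n, k) in sequentially \<times>\<^sub>F sequentially. norm (Gs k n) \<le> real n * x ^ n"
    using Gs_bound by (intro always_eventually) auto
  ultimately have *: "summable (\<lambda>n. norm (Gl n))" "(\<lambda>k. suminf (Gs k)) \<longlonglongrightarrow> suminf Gl"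
    \<comment> \<open>The dominating series with terms \<open>real n * x ^ n\<close> does not depend
      on \<open>k\<close>.\<close>
    using tannerys_theorem[of "\<lambda>n k. Gs k n" Gl sequentially "\<lambda>n. real n * x ^ n"] summable_nx by auto
  show "(\<lambda>k. P k / Q k) \<longlonglongrightarrow> (real b - 1)\<^sup>2 * suminf Gl"
    unfolding P_eq_suminf by (intro tendsto_mult_left *)
  show "summable Gl" using *(1) by (rule summable_norm_cancel)
qed

text \<open>Summation by parts turns the heights \<open>G\<close> into their increments. One index
  \<open>k\<close> per \<open>n\<close> suffices, so its parity can be chosen to suit the
  rounding.\<close>

lemma P_limit_word:
  fixes s :: "nat \<Rightarrow> int"
  assumes "\<And>n. n \<ge> 1 \<Longrightarrow> \<exists>k>n. G k (int n + 1) - G k (int n) = s n"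
  shows "(\<lambda>k. P k / Q k) \<longlonglongrightarrow> (real b - 1) * (\<Sum>n. real_of_int (s (Suc n)) / real b ^ Suc n)"
proof -
  have s: "s n = G (Suc n) (int (Suc n)) - G n (int n)" if n: "n \<ge> 1" for n
  proof -
    obtain k where k: "k > n" "G k (int n + 1) - G k (int n) = s n" using assms[OF n] by blast
    then show ?thesis using G_stable[of n k] G_stable[of "Suc n" k] n by (simp add: add.commute)
  qed
  have Gl1: "Gl 0 = 0" "Gl (Suc 0) = 0" using G_1[of 1] by (simp_all add: Gl_def)
  have "(\<lambda>n. Gl (Suc n)) sums suminf Gl"
    using summable_sums[OF summable_Gl] sums_Suc_iff[of Gl "suminf Gl"] Gl1 by simp
  moreover from this have "(\<lambda>n. Gl (Suc (Suc n))) sums suminf Gl"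
    using sums_Suc_iff[of "\<lambda>n. Gl (Suc n)" "suminf Gl"] Gl1 by simp
  then have "(\<lambda>n. real b * Gl (Suc (Suc n))) sums (real b * suminf Gl)" by (rule sums_mult)
  ultimately have "(\<lambda>n. real b * Gl (Suc (Suc n)) - Gl (Suc n)) sums (real b * suminf Gl - suminf Gl)"
    by (intro sums_diff)
  moreover have "real b * Gl (Suc (Suc n)) - Gl (Suc n) = real_of_int (s (Suc n)) / real b ^ Suc n" for n
    using s[of "Suc n"] b_pos unfolding Gl_def by (simp add: field_simps power_one_over)
  ultimately have "(\<Sum>n. real_of_int (s (Suc n)) / real b ^ Suc n) = (real b - 1) * suminf Gl"
    by (simp add: sums_unique[symmetric] algebra_simps)
  then show ?thesis using P_limit by (simp only: power2_eq_square mult.assoc)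
qed

end

subsection \<open>Convergence to the Sturmian number\<close>

text \<open>An integer value would represent \<rho> with the coefficient \<open>1 - n\<close> of
  \<theta>, at most 0, besides one that is at least 1; then \<theta> would be rational.\<close>

lemma case_A_irrational:
  assumes "case_A \<theta> \<rho>" "\<theta> \<notin> \<rat>" "n \<ge> 1"
  shows "real n * \<theta> + (\<rho> - \<theta>) \<notin> \<int>"
proof
  assume "real n * \<theta> + (\<rho> - \<theta>) \<in> \<int>"
  then obtain z where z: "real n * \<theta> + (\<rho> - \<theta>) = real_of_int z" by (auto elim: Ints_cases)
  then have "\<rho> = real_of_int (1 - int n) * \<theta> + real_of_int z" by (simp add: algebra_simps)
  then obtain m y where m: "m \<ge> (1::int)" "\<rho> = real_of_int m * \<theta> + real_of_int y"
    using assms(1) unfolding case_A_def by blast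
  have "real_of_int (m - 1 + int n) * \<theta> = real_of_int (z - y)"
    using z m(2) by (simp add: algebra_simps)
  moreover have "m - 1 + int n > 0" using m assms(3) by simp
  ultimately have "\<theta> = real_of_int (z - y) / real_of_int (m - 1 + int n)"
    by (simp add: field_simps)
  then show False using assms(2) by (metis Rats_divide Rats_of_int)
qed

section \<open>Approximation of the slope by its convergents\<close>

context ostrowski_digits begin

lemma run_partial_quotients:
  "cf_run (map (\<lambda>k. real_of_int (a k)) [1..<Suc n]) (1, 0) = (real_of_int (q n), real_of_int (cden a n))"
  "cf_run (map (\<lambda>k. real_of_int (a k)) [1..<Suc n]) (0, 1) = (real_of_int (p n), real_of_int (cnum a n))"
  by (induction n) simp_all

lemma conv_eq: "cf_conv (\<lambda>k. real_of_int (a k)) n = real_of_int (p n) / real_of_int (q n)"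
proof -
  have "\<forall>z\<in>set (map (\<lambda>k. real_of_int (a k)) [1..<Suc n]). z \<ge> 1"
    using a_pos by (auto simp del: upt_Suc)
  from cfrac_list_eq_run[OF this] show ?thesis by (simp only: run_partial_quotients fst_conv)
qed

context
  fixes \<theta> :: real
  assumes cf: "has_cfrac \<theta> (\<lambda>k. real_of_int (a k))" and irr: "\<theta> \<notin> \<rat>"
begin

lemma theta_approx: "\<bar>real_of_int (p n) / real_of_int (q n) - \<theta>\<bar> \<le> 1 / (real_of_int (q n))\<^sup>2"
proof -
  have "(\<lambda>m. \<bar>cf_conv (\<lambda>k. real_of_int (a k)) m - cf_conv (\<lambda>k. real_of_int (a k)) n\<bar>)
      \<longlonglongrightarrow> \<bar>\<theta> - cf_conv (\<lambda>k. real_of_int (a k)) n\<bar>"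
    using cf unfolding has_cfrac_def by (intro tendsto_intros) auto
  moreover have "\<forall>\<^sub>F m in sequentially.
      \<bar>cf_conv (\<lambda>k. real_of_int (a k)) m - cf_conv (\<lambda>k. real_of_int (a k)) n\<bar> \<le> 1 / (real_of_int (q n))\<^sup>2"
  proof (rule eventually_sequentiallyI[of n])
    fix m assume "n \<le> m"
    then show "\<bar>cf_conv (\<lambda>k. real_of_int (a k)) m - cf_conv (\<lambda>k. real_of_int (a k)) n\<bar> \<le> 1 / (real_of_int (q n))\<^sup>2"
      using cf_conv_dist[of "\<lambda>k. real_of_int (a k)" n m] a_pos
      unfolding run_partial_quotients by simp
  qed
  ultimately have "\<bar>\<theta> - cf_conv (\<lambda>k. real_of_int (a k)) n\<bar> \<le> 1 / (real_of_int (q n))\<^sup>2"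
    by (intro tendsto_upperbound[of _ _ sequentially]) auto
  then show ?thesis unfolding conv_eq by (simp add: abs_minus_commute)
qed

text \<open>The error is at most 1/q_k^2, so factors of order q_k, such as n + t_k, are
  harmless.\<close>

lemma scaled_error_tendsto_0:
  assumes "\<And>k. \<bar>y k\<bar> \<le> C * real_of_int (q k)"
  shows "(\<lambda>k. y k * (real_of_int (p k) / real_of_int (q k) - \<theta>)) \<longlonglongrightarrow> 0"
proof (rule Lim_null_comparison)
  have "0 \<le> C * real_of_int (q 0)" using assms[of 0] abs_ge_zero[of "y 0"] by linarith
  then have C: "C \<ge> 0" by simp
  show "\<forall>\<^sub>F k in sequentially. norm (y k * (real_of_int (p k) / real_of_int (q k) - \<theta>)) \<le> C * (1 / real k)"
  proof (rule eventually_sequentiallyI[of 1])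
    fix k :: nat assume k: "1 \<le> k"
    have qk: "real_of_int (q k) \<ge> real k" "real_of_int (q k) > 0" using q_ge[of k] q_pos[of k] by linarith+
    have "norm (y k * (real_of_int (p k) / real_of_int (q k) - \<theta>)) \<le>
          (C * real_of_int (q k)) * (1 / (real_of_int (q k))\<^sup>2)"
      unfolding real_norm_def abs_mult using assms[of k] theta_approx[of k] qk C
      by (intro mult_mono) auto
    also have "\<dots> = C * (1 / real_of_int (q k))" using qk by (simp add: power2_eq_square)
    also have "\<dots> \<le> C * (1 / real k)" using qk k C by (intro mult_left_mono frac_le) auto
    finally show "norm (y k * (real_of_int (p k) / real_of_int (q k) - \<theta>)) \<le> C * (1 / real k)" .
  qed
  show "(\<lambda>k. C * (1 / real k)) \<longlonglongrightarrow> 0"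
    using tendsto_mult_right_zero[OF lim_1_over_n[where 'a = real], of C] by simp
qed

lemma q_real_ge_1: "real_of_int (q k) \<ge> 1"
  using q_pos[of k] by linarith

lemma partial_sum_eq: "(\<Sum>j<k. real_of_int (\<beta> (Suc j)) * theta_err \<theta> a j) =
    real_of_int (t k) * \<theta> - real_of_int (tp k)"
  by (induction k) (simp_all add: t_0 tp_def t_Suc theta_err_def algebra_simps del: cden.simps cnum.simps)

text \<open>For even \<open>k\<close> the value \<open>G\<close> is the floor of \<open>X k\<close>,
  and the floor is locally constant at the limit because that is no integer.\<close>

lemma G_even_eventually:
  assumes sums: "(\<lambda>k. real_of_int (\<beta> (Suc k)) * theta_err \<theta> a k) sums \<sigma>"
    and ni: "real n * \<theta> + \<sigma> \<notin> \<int>"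
  shows "\<forall>\<^sub>F k in sequentially. even k \<longrightarrow> G k (int n) = \<lfloor>real n * \<theta> + \<sigma>\<rfloor>"
proof -
  define X where "X k = real_of_int ((int n + t k) * p k) / real_of_int (q k) - real_of_int (tp k)" for k
  have "\<bar>real_of_int (int n + t k)\<bar> \<le> (real n + 1) * real_of_int (q k)" for k
  proof -
    have "real n * 1 \<le> real n * real_of_int (q k)" using q_real_ge_1[of k] by (intro mult_left_mono) auto
    moreover have "real_of_int (t k) \<le> real_of_int (q k)" "real_of_int (t k) \<ge> 0"
      using t_less[of k] t_nonneg[of k] by linarith+
    ultimately show ?thesis by (simp add: algebra_simps)
  qed
  from scaled_error_tendsto_0[OF this]
  have "(\<lambda>k. real n * \<theta> + (real_of_int (t k) * \<theta> - real_of_int (tp k)) +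
      real_of_int (int n + t k) * (real_of_int (p k) / real_of_int (q k) - \<theta>)) \<longlonglongrightarrow> real n * \<theta> + \<sigma> + 0"
    using sums unfolding sums_def partial_sum_eq by (intro tendsto_add tendsto_const) auto
  moreover have "X = (\<lambda>k. real n * \<theta> + (real_of_int (t k) * \<theta> - real_of_int (tp k)) +
      real_of_int (int n + t k) * (real_of_int (p k) / real_of_int (q k) - \<theta>))"
    by (rule ext) (simp add: X_def algebra_simps)
  ultimately have "X \<longlonglongrightarrow> real n * \<theta> + \<sigma>" by (simp only: add_0_right)
  then have "\<forall>\<^sub>F k in sequentially. \<lfloor>X k\<rfloor> = \<lfloor>real n * \<theta> + \<sigma>\<rfloor>"
    using ni by (rule eventually_floor_eq)
  then show ?thesis
  proof eventually_elim
    case (elim k)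
    have "\<lfloor>X k\<rfloor> = ((int n + t k) * p k) div q k - tp k"
      unfolding X_def by (simp only: floor_diff_of_int floor_divide_of_int_eq)
    then show ?case using elim by (simp add: G_def)
  qed
qed

lemma P_limit_case_A:
  assumes A: "case_A \<theta> \<rho>"
    and sums: "(\<lambda>k. real_of_int (\<beta> (Suc k)) * theta_err \<theta> a k) sums (\<rho> - \<theta>)"
  shows "(\<lambda>k. P k / Q k) \<longlonglongrightarrow> xi_floor b \<theta> \<rho>" "xi_ceil b \<theta> \<rho> = xi_floor b \<theta> \<rho>"
proof -
  note ni = case_A_irrational[OF A irr]
  show "(\<lambda>k. P k / Q k) \<longlonglongrightarrow> xi_floor b \<theta> \<rho>"
    unfolding xi_floor_def
  proof (rule P_limit_word)
    fix n :: nat assume n: "n \<ge> 1"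
    have "\<forall>\<^sub>F k in sequentially. even k \<longrightarrow> G k (int n) = \<lfloor>real n * \<theta> + (\<rho> - \<theta>)\<rfloor>"
      by (rule G_even_eventually[OF sums ni[OF n]])
    moreover have "\<forall>\<^sub>F k in sequentially. even k \<longrightarrow> G k (int (Suc n)) = \<lfloor>real (Suc n) * \<theta> + (\<rho> - \<theta>)\<rfloor>"
      by (rule G_even_eventually[OF sums ni]) simp
    ultimately have "\<forall>\<^sub>F k in sequentially. even k \<longrightarrow> G k (int n + 1) - G k (int n) = sturm_floor \<theta> \<rho> n"
    proof eventually_elim
      case (elim k)
      then show ?case by (auto simp: sturm_floor_def algebra_simps)
    qed
    then obtain K where K: "\<And>k. k \<ge> K \<Longrightarrow> even k \<Longrightarrow> G k (int n + 1) - G k (int n) = sturm_floor \<theta> \<rho> n"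
      unfolding eventually_sequentially by blast
    show "\<exists>k>n. G k (int n + 1) - G k (int n) = sturm_floor \<theta> \<rho> n"
      using K[of "2 * (K + n + 1)"] by (intro exI[of _ "2 * (K + n + 1)"]) auto
  qed
  have "sturm_ceil \<theta> \<rho> (Suc n) = sturm_floor \<theta> \<rho> (Suc n)" for n
  proof -
    have "\<lceil>z\<rceil> = \<lfloor>z\<rfloor> + 1" if "z \<notin> \<int>" for z :: real
      using that by (simp add: ceiling_altdef) (metis Ints_of_int)
    moreover have "real (Suc n) * \<theta> + \<rho> \<notin> \<int>" "(real (Suc n) - 1) * \<theta> + \<rho> \<notin> \<int>"
      using ni[of "Suc (Suc n)"] ni[of "Suc n"] by (simp_all add: algebra_simps)
    ultimately show ?thesis unfolding sturm_ceil_def sturm_floor_def by presburger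
  qed
  then show "xi_ceil b \<theta> \<rho> = xi_floor b \<theta> \<rho>" unfolding xi_ceil_def xi_floor_def by simp
qed

text \<open>For \<open>j = 0\<close> both sides are 0, although the limit is an integer; otherwise
  irrationality makes the floor locally constant at the limit.\<close>

lemma div_eventually: "\<forall>\<^sub>F k in sequentially. (j * p k) div q k = \<lfloor>real_of_int j * \<theta>\<rfloor>"
proof (cases "j = 0")
  case False
  have "\<bar>real_of_int j\<bar> \<le> \<bar>real_of_int j\<bar> * real_of_int (q k)" for k
    using q_real_ge_1[of k] mult_left_mono[of 1 "real_of_int (q k)" "\<bar>real_of_int j\<bar>"] by simp
  from scaled_error_tendsto_0[OF this]
  have "(\<lambda>k. real_of_int j * \<theta> + real_of_int j * (real_of_int (p k) / real_of_int (q k) - \<theta>))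
      \<longlonglongrightarrow> real_of_int j * \<theta> + 0"
    by (intro tendsto_add tendsto_const)
  moreover have "real_of_int j * \<theta> + real_of_int j * (real_of_int (p k) / real_of_int (q k) - \<theta>) =
      real_of_int (j * p k) / real_of_int (q k)" for k by (simp add: algebra_simps)
  ultimately have "(\<lambda>k. real_of_int (j * p k) / real_of_int (q k)) \<longlonglongrightarrow> real_of_int j * \<theta>" by simp
  moreover have "real_of_int j * \<theta> \<notin> \<int>"
  proof
    assume "real_of_int j * \<theta> \<in> \<int>"
    then obtain z where "real_of_int j * \<theta> = real_of_int z" by (auto elim: Ints_cases)
    then have "\<theta> = real_of_int z / real_of_int j" using False by (simp add: field_simps)
    then show False using irr by (metis Rats_divide Rats_of_int)
  qed
  ultimately have "\<forall>\<^sub>F k in sequentially. \<lfloor>real_of_int (j * p k) / real_of_int (q k)\<rfloor> = \<lfloor>real_of_int j * \<theta>\<rfloor>"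
    by (rule eventually_floor_eq)
  then show ?thesis by (simp only: floor_divide_of_int_eq)
qed simp

lemma G_shift_multiple:
  assumes "t k = q k - m"
  shows "G k n = ((n - m) * p k - (if odd k then 1 else 0)) div q k + p k - tp k"
proof -
  have "(n + t k) * p k - (if odd k then 1 else 0) = (n - m) * p k - (if odd k then 1 else 0) + p k * q k"
    unfolding assms by (simp add: algebra_simps del: cden.simps cnum.simps)
  moreover have "q k \<noteq> 0" using q_pos[of k] by simp
  ultimately show ?thesis by (simp only: G_def div_mult_self1) simp
qed

text \<open>Where t_k = q_k - m the periodic word is shifted by exactly - m, so no limit of t_k is
  involved. Even \<open>k\<close> means rounding by floor.\<close>

lemma P_limit_case_B_floor:
  assumes \<rho>: "\<rho> - \<theta> = - real_of_int m * \<theta> + real_of_int y"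
    and tm: "\<And>K. \<exists>k\<ge>K. even k \<and> t k = q k - m"
  shows "(\<lambda>k. P k / Q k) \<longlonglongrightarrow> xi_floor b \<theta> \<rho>"
  unfolding xi_floor_def
proof (rule P_limit_word)
  fix n :: nat assume "n \<ge> 1"
  have "\<forall>\<^sub>F k in sequentially. ((int n - m) * p k) div q k = \<lfloor>real_of_int (int n - m) * \<theta>\<rfloor> \<and>
     ((int n + 1 - m) * p k) div q k = \<lfloor>real_of_int (int n + 1 - m) * \<theta>\<rfloor>"
    by (intro eventually_conj div_eventually)
  then obtain K where K: "\<And>k. k \<ge> K \<Longrightarrow> ((int n - m) * p k) div q k = \<lfloor>real_of_int (int n - m) * \<theta>\<rfloor> \<and>
     ((int n + 1 - m) * p k) div q k = \<lfloor>real_of_int (int n + 1 - m) * \<theta>\<rfloor>"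
    unfolding eventually_sequentially by blast
  obtain k where k: "k \<ge> K + n + 1" "even k" "t k = q k - m" using tm by blast
  have "G k (int n + 1) - G k (int n) = ((int n + 1 - m) * p k) div q k - ((int n - m) * p k) div q k"
    unfolding G_shift_multiple[OF k(3)] using k(2) by simp
  also have "\<dots> = \<lfloor>real_of_int (int n + 1 - m) * \<theta>\<rfloor> - \<lfloor>real_of_int (int n - m) * \<theta>\<rfloor>"
    using K[of k] k by simp
  also have "\<dots> = sturm_floor \<theta> \<rho> n"
  proof -
    have "real n * \<theta> + \<rho> = real_of_int (int n + 1 - m) * \<theta> + real_of_int y"
      "(real n - 1) * \<theta> + \<rho> = real_of_int (int n - m) * \<theta> + real_of_int y"
      using \<rho> by (simp_all add: algebra_simps)
    then show ?thesis unfolding sturm_floor_def by (simp only: floor_add_int[symmetric])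
  qed
  finally show "\<exists>k>n. G k (int n + 1) - G k (int n) = sturm_floor \<theta> \<rho> n"
    using k(1) by (intro exI[of _ k]) auto
qed

lemma P_limit_case_B_ceil:
  assumes \<rho>: "\<rho> - \<theta> = - real_of_int m * \<theta> + real_of_int y"
    and tm: "\<And>K. \<exists>k\<ge>K. odd k \<and> t k = q k - m"
  shows "(\<lambda>k. P k / Q k) \<longlonglongrightarrow> xi_ceil b \<theta> \<rho>"
  unfolding xi_ceil_def
proof (rule P_limit_word)
  fix n :: nat assume "n \<ge> 1"
  have "\<forall>\<^sub>F k in sequentially. ((m - int n) * p k) div q k = \<lfloor>real_of_int (m - int n) * \<theta>\<rfloor> \<and>
     ((m - int n - 1) * p k) div q k = \<lfloor>real_of_int (m - int n - 1) * \<theta>\<rfloor>"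
    by (intro eventually_conj div_eventually)
  then obtain K where K: "\<And>k. k \<ge> K \<Longrightarrow> ((m - int n) * p k) div q k = \<lfloor>real_of_int (m - int n) * \<theta>\<rfloor> \<and>
     ((m - int n - 1) * p k) div q k = \<lfloor>real_of_int (m - int n - 1) * \<theta>\<rfloor>"
    unfolding eventually_sequentially by blast
  obtain k where k: "k \<ge> K + n + 1" "odd k" "t k = q k - m" using tm by blast
  \<comment> \<open>For odd \<open>k\<close> the rounding is ceiling minus 1; negation turns it into
    a floor, to which \<open>div_eventually\<close> applies.\<close>
  have neg: "((z - m) * p k - 1) div q k = - (((m - z) * p k) div q k) - 1" for z
    using minus_div_eq[OF q_pos[of k], of "(z - m) * p k"] by (simp add: algebra_simps del: cden.simps cnum.simps)
  have "G k (int n + 1) - G k (int n) = ((m - int n) * p k) div q k - ((m - int n - 1) * p k) div q k"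
    unfolding G_shift_multiple[OF k(3)] using k(2) neg[of "int n"] neg[of "int n + 1"]
    by (simp add: algebra_simps del: cden.simps cnum.simps)
  also have "\<dots> = \<lfloor>real_of_int (m - int n) * \<theta>\<rfloor> - \<lfloor>real_of_int (m - int n - 1) * \<theta>\<rfloor>"
    using K[of k] k by simp
  also have "\<dots> = sturm_ceil \<theta> \<rho> n"
  proof -
    have "- (real n * \<theta> + \<rho>) = real_of_int (m - int n - 1) * \<theta> - real_of_int y"
      "- ((real n - 1) * \<theta> + \<rho>) = real_of_int (m - int n) * \<theta> - real_of_int y"
      using \<rho> by (simp_all add: algebra_simps)
    then show ?thesis unfolding sturm_ceil_def ceiling_def by (simp only: floor_diff_of_int)
  qed
  finally show "\<exists>k>n. G k (int n + 1) - G k (int n) = sturm_ceil \<theta> \<rho> n"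
    using k(1) by (intro exI[of _ k]) auto
qed

end

end

subsection \<open>Digits in the exceptional case\<close>

text \<open>A full digit at k + 2 adds a_(k+2) q_(k+1), which is q_(k+2) - q_k.\<close>

lemma (in ostrowski_digits) t_full_digit_step:
  assumes "t k = q k - m" "\<beta> (k + 1) = 0" "\<beta> (k + 2) = a (k + 2)"
  shows "t (k + 2) = q (k + 2) - m"
  using assms t_Suc[of k] t_Suc[of "k + 1"] by simp

lemma case_B_digits_one:
  assumes a: "\<And>k. k \<ge> 1 \<Longrightarrow> a k \<ge> (1::int)" and b: "b \<ge> 2"
    and \<beta>: "\<And>k. k \<ge> 1 \<Longrightarrow> \<beta> k = (if k = 1 then a 1 - 1 else if odd k then a k else 0)"
    and \<beta>': "\<And>k. k \<ge> 1 \<Longrightarrow> \<beta>' k = (if even k then a k else 0)"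
  shows "ostrowski_digits b a \<beta>" "ostrowski_digits b a \<beta>'"
    "t_seq a \<beta> (2 * j + 1) = conv_q a (2 * j + 1) - 1"
    "t_seq a \<beta>' (2 * j + 2) = conv_q a (2 * j + 2) - 1"
proof -
  show B: "ostrowski_digits b a \<beta>"
  proof
    fix k :: nat assume k: "1 \<le> k"
    show "1 \<le> a k" "0 \<le> \<beta> k" "\<beta> k \<le> a k" using a[OF k] \<beta>[OF k] by auto
    show "\<beta> k = 0" if "\<beta> (Suc k) = a (Suc k)"
      using \<beta>[of "Suc k"] \<beta>[OF k] a[of "Suc k"] k that by (auto split: if_splits)
  qed (use b \<beta>[of 1] in auto)
  interpret B: ostrowski_digits b a \<beta> by (rule B)
  show B': "ostrowski_digits b a \<beta>'"
  proof
    fix k :: nat assume k: "1 \<le> k"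
    show "1 \<le> a k" "0 \<le> \<beta>' k" "\<beta>' k \<le> a k" using a[OF k] \<beta>'[OF k] by auto
    show "\<beta>' k = 0" if "\<beta>' (Suc k) = a (Suc k)"
      using \<beta>'[of "Suc k"] \<beta>'[OF k] a[of "Suc k"] k that by (auto split: if_splits)
  qed (use b \<beta>'[of 1] a[of 1] in auto)
  interpret B': ostrowski_digits b a \<beta>' by (rule B')
  show "t_seq a \<beta> (2 * j + 1) = conv_q a (2 * j + 1) - 1"
  proof (induction j)
    case 0
    show ?case using \<beta>[of 1] by (simp add: B.t_Suc B.t_0)
  next
    case (Suc j)
    have step: "\<beta> (2 * j + 1 + 1) = 0" "\<beta> (2 * j + 1 + 2) = a (2 * j + 1 + 2)"
      using \<beta>[of "2 * j + 1 + 1"] \<beta>[of "2 * j + 1 + 2"] by simp_all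
    have eq: "2 * Suc j + 1 = 2 * j + 1 + 2" by simp
    show ?case unfolding eq by (rule B.t_full_digit_step[OF Suc step])
  qed
  show "t_seq a \<beta>' (2 * j + 2) = conv_q a (2 * j + 2) - 1"
  proof (induction j)
    case 0
    show ?case using \<beta>'[of 1] \<beta>'[of 2] B'.t_Suc[of 0] B'.t_Suc[of 1] B'.t_0
      by (simp add: numeral_2_eq_2)
  next
    case (Suc j)
    have step: "\<beta>' (2 * j + 2 + 1) = 0" "\<beta>' (2 * j + 2 + 2) = a (2 * j + 2 + 2)"
      using \<beta>'[of "2 * j + 2 + 1"] \<beta>'[of "2 * j + 2 + 2"] by simp_all
    have eq: "2 * Suc j + 2 = 2 * j + 2 + 2" by simp
    show ?case unfolding eq by (rule B'.t_full_digit_step[OF Suc step])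
  qed
qed

lemma nat_beyond_cases:
  fixes k l :: nat
  obtains "k \<le> l" | "k = l + 1" | j where "j \<ge> 1" "k = l + 2 * j" | j where "j \<ge> 1" "k = l + 2 * j + 1"
proof -
  assume *: "k \<le> l \<Longrightarrow> thesis" "k = l + 1 \<Longrightarrow> thesis"
    "\<And>j. 1 \<le> j \<Longrightarrow> k = l + 2 * j \<Longrightarrow> thesis" "\<And>j. 1 \<le> j \<Longrightarrow> k = l + 2 * j + 1 \<Longrightarrow> thesis"
  show thesis
  proof (cases "k \<le> l + 1")
    case True
    then show ?thesis using *(1,2) by linarith
  next
    case False
    define j where "j = (k - l) div 2"
    have "j \<ge> 1" "k = l + 2 * j \<or> k = l + 2 * j + 1" using False unfolding j_def by presburger+
    then show ?thesis using *(3,4) by blast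
  qed
qed

text \<open>The point is that \<beta>' obeys the digit rules although digit l + 1 is raised by one;
  this follows from q_l < m.\<close>

lemma case_B_digits_ge_2:
  assumes a: "\<And>k. k \<ge> 1 \<Longrightarrow> a k \<ge> (1::int)" and b: "b \<ge> 2"
    and m: "conv_q a l < m"
    and os: "ostrowski_int a (l + 1) (conv_q a (l + 1) - m) \<beta>"
    and \<beta>: "\<And>j. j \<ge> 1 \<Longrightarrow> \<beta> (l + 2 * j) = 0 \<and> \<beta> (l + 2 * j + 1) = a (l + 2 * j + 1)"
    and low: "\<And>i. 1 \<le> i \<Longrightarrow> i \<le> l \<Longrightarrow> \<beta>' i = \<beta> i"
    and mid: "\<beta>' (l + 1) = \<beta> (l + 1) + 1" "\<beta>' (l + 2) = a (l + 2) - 1"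
    and high: "\<And>j. j \<ge> 1 \<Longrightarrow> \<beta>' (l + 2 * j + 1) = 0 \<and> \<beta>' (l + 2 * j + 2) = a (l + 2 * j + 2)"
  shows "ostrowski_digits b a \<beta>" "ostrowski_digits b a \<beta>'"
    "t_seq a \<beta> (l + 2 * j + 1) = conv_q a (l + 2 * j + 1) - m"
    "t_seq a \<beta>' (l + 2 * j + 2) = conv_q a (l + 2 * j + 2) - m"
proof -
  have o1: "t_seq a \<beta> (l + 1) = conv_q a (l + 1) - m" "0 \<le> \<beta> 1" "\<beta> 1 \<le> a 1 - 1"
    and o2: "\<And>j. 1 \<le> j \<Longrightarrow> j \<le> l + 1 \<Longrightarrow> 0 \<le> \<beta> j \<and> \<beta> j \<le> a j"
    and o3: "\<And>j. 1 \<le> j \<Longrightarrow> j < l + 1 \<Longrightarrow> \<beta> (j + 1) = a (j + 1) \<Longrightarrow> \<beta> j = 0"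
    using os unfolding ostrowski_int_def t_seq_def by auto
  show B: "ostrowski_digits b a \<beta>"
  proof
    fix k :: nat assume k: "1 \<le> k"
    show "1 \<le> a k" by (rule a[OF k])
    show "0 \<le> \<beta> k" "\<beta> k \<le> a k"
      using o2[of k] k \<beta> a[OF k] by (cases rule: nat_beyond_cases[of k l]; force)+
    show "\<beta> k = 0" if full: "\<beta> (Suc k) = a (Suc k)"
    proof (cases rule: nat_beyond_cases[of "Suc k" l])
      case (3 j)
      then show ?thesis using \<beta>[of j] full a[of "Suc k"] by simp
    next
      case (4 j)
      then show ?thesis using \<beta>[of j] by simp
    qed (use o3[of k] k full in auto)
  qed (use b o1 in auto)
  interpret B: ostrowski_digits b a \<beta> by (rule B)
  \<comment> \<open>The right side is q_(l+1) - q_l, and the left side is q_(l+1) - m.\<close>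
  have tl: "t_seq a \<beta> l + \<beta> (l + 1) * conv_q a l < (a (l + 1) - 1) * conv_q a l + cden a l"
    using o1(1) m B.t_Suc[of l] by (simp add: algebra_simps)
  have cq: "cden a l \<le> conv_q a l"
    using B.q_mono by (cases l) auto
  have lt: "\<beta> (l + 1) < a (l + 1)"
  proof -
    have "\<beta> (l + 1) * conv_q a l < a (l + 1) * conv_q a l"
      using tl B.t_nonneg[of l] cq by (simp add: algebra_simps)
    then show ?thesis using B.q_pos[of l] by (simp add: mult_less_cancel_right)
  qed
  \<comment> \<open>If the raised digit is full, the bound leaves t_l < q_(l-1), which rules out l =
    0 and a nonzero digit at l.\<close>
  have z: "l \<ge> 1 \<and> \<beta> l = 0" if "\<beta> (l + 1) + 1 = a (l + 1)"
  proof -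
    have "a (l + 1) - 1 = \<beta> (l + 1)" using that by simp
    then have tc: "t_seq a \<beta> l < cden a l" using tl by simp
    then obtain i where i: "l = Suc i" using B.t_nonneg[of l] by (cases l) auto
    then have "\<beta> l * conv_q a i < 1 * conv_q a i"
      using tc B.t_Suc[of i] B.t_nonneg[of i] by simp
    then have "\<beta> l < 1" using B.q_pos[of i] by (simp only: mult_less_cancel_right_pos)
    then show ?thesis using B.digit_nonneg[of l] i by simp
  qed
  have high': "\<beta>' (l + 2 * j) = (if j = 1 then a (l + 2) - 1 else a (l + 2 * j))" if "j \<ge> 1" for j
  proof (cases "j = 1")
    case False
    then have "j - 1 \<ge> 1" "l + 2 * (j - 1) + 2 = l + 2 * j" using that by auto
    then show ?thesis using high[of "j - 1"] False by metis
  qed (use mid in simp)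
  show B': "ostrowski_digits b a \<beta>'"
  proof
    fix k :: nat assume k: "1 \<le> k"
    show "1 \<le> a k" by (rule a[OF k])
    show "0 \<le> \<beta>' k"
    proof (cases rule: nat_beyond_cases[of k l])
      case (3 j)
      then show ?thesis using high'[of j] a[of k] k by auto
    qed (use o2[of k] k low[of k] mid high in auto)
    show "\<beta>' k \<le> a k"
    proof (cases rule: nat_beyond_cases[of k l])
      case (3 j)
      then show ?thesis using high'[of j] by auto
    next
      case (4 j)
      then show ?thesis using high[of j] a[OF k] by simp
    qed (use o2[of k] k low[of k] mid lt in auto)
    show "\<beta>' k = 0" if full: "\<beta>' (Suc k) = a (Suc k)"
    proof (cases rule: nat_beyond_cases[of "Suc k" l])
      case 1
      then show ?thesis using low[of k] low[of "Suc k"] k full o3[of k] by simp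
    next
      case 2
      then show ?thesis using z full mid low[of k] k by simp
    next
      case (3 j)
      then have "j \<noteq> 1" using full mid by auto
      then obtain i where "j = Suc i" "i \<ge> 1" using 3 by (cases j) auto
      then show ?thesis using high[of i] 3 by simp
    next
      case (4 j)
      then show ?thesis using high[of j] full a[of "Suc k"] by simp
    qed
  next
    show "\<beta>' 1 < a 1"
    proof (cases "l = 0")
      case True
      then show ?thesis using z lt mid by force
    next
      case False
      then show ?thesis using low[of 1] o1 by simp
    qed
  qed (use b in auto)
  interpret B': ostrowski_digits b a \<beta>' by (rule B')
  show "t_seq a \<beta> (l + 2 * j + 1) = conv_q a (l + 2 * j + 1) - m"
  proof (induction j)
    case 0
    show ?case using o1(1) by simp
  next
    case (Suc j)
    have step: "\<beta> (l + 2 * j + 1 + 1) = 0" "\<beta> (l + 2 * j + 1 + 2) = a (l + 2 * j + 1 + 2)"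
      using \<beta>[of "j + 1"] by (simp_all add: eval_nat_numeral)
    have eq: "l + 2 * Suc j + 1 = l + 2 * j + 1 + 2" by simp
    show ?case unfolding eq by (rule B.t_full_digit_step[OF Suc step])
  qed
  have "t_seq a \<beta>' l = t_seq a \<beta> l"
    unfolding t_seq_def by (rule sum.cong) (use low in auto)
  \<comment> \<open>Raising digit l + 1 adds q_l, and digit l + 2 contributes q_(l+2) - q_l -
    q_(l+1), which makes up exactly for q_(l+1) - m.\<close>
  then have "t_seq a \<beta>' (l + 2) = t_seq a \<beta> l + (\<beta> (l + 1) + 1) * conv_q a l + (a (l + 2) - 1) * conv_q a (l + 1)"
    using B'.t_Suc[of l] B'.t_Suc[of "l + 1"] mid by (simp del: cden.simps)
  also have "\<dots> = t_seq a \<beta> (l + 1) + conv_q a l + a (l + 2) * conv_q a (l + 1) - conv_q a (l + 1)"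
    using B.t_Suc[of l] by (simp add: algebra_simps del: cden.simps)
  also have "\<dots> = conv_q a (l + 2) - m" using o1(1) by simp
  finally have t2: "t_seq a \<beta>' (l + 2) = conv_q a (l + 2) - m" .
  show "t_seq a \<beta>' (l + 2 * j + 2) = conv_q a (l + 2 * j + 2) - m"
  proof (induction j)
    case 0
    show ?case using t2 by simp
  next
    case (Suc j)
    have step: "\<beta>' (l + 2 * j + 2 + 1) = 0" "\<beta>' (l + 2 * j + 2 + 2) = a (l + 2 * j + 2 + 2)"
      using high[of "j + 1"] by (simp_all add: eval_nat_numeral)
    have eq: "l + 2 * Suc j + 2 = l + 2 * j + 2 + 2" by simp
    show ?case unfolding eq by (rule B'.t_full_digit_step[OF Suc step])
  qed
qed

text \<open>So r_k = m at alternate indices: of parity l + 1 for \<beta>, of parity l for \<beta>'.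
  The choice prescribed by the parity of l thus yields even indices for the floor and odd ones for
  the ceiling.\<close>

lemma case_B_digits_shift:
  assumes a: "\<And>k. k \<ge> 1 \<Longrightarrow> a k \<ge> (1::int)" and b: "b \<ge> 2" and B: "case_B_digits a m l \<beta> \<beta>'"
  shows "ostrowski_digits b a \<beta> \<and> ostrowski_digits b a \<beta>' \<and>
    (\<forall>j. t_seq a \<beta> (l + 2 * j + 1) = conv_q a (l + 2 * j + 1) - m) \<and>
    (\<forall>j. t_seq a \<beta>' (l + 2 * j + 2) = conv_q a (l + 2 * j + 2) - m)"
  using B unfolding case_B_digits_def
proof (elim disjE conjE)
  assume l: "m = 1" "l = 0"
    and *: "\<forall>k\<ge>1. \<beta> k = (if k = 1 then a 1 - 1 else if odd k then a k else 0)"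
      "\<forall>k\<ge>1. \<beta>' k = (if even k then a k else 0)"
  show ?thesis
    unfolding l using case_B_digits_one[of a b \<beta> \<beta>', OF a b] * by (simp del: cden.simps)
next
  assume "conv_q a l < m" "ostrowski_int a (l + 1) (conv_q a (l + 1) - m) \<beta>"
    "\<forall>j\<ge>1. \<beta> (l + 2 * j) = 0 \<and> \<beta> (l + 2 * j + 1) = a (l + 2 * j + 1)"
    "\<forall>i. 1 \<le> i \<and> i \<le> l \<longrightarrow> \<beta>' i = \<beta> i" "\<beta>' (l + 1) = \<beta> (l + 1) + 1"
    "\<beta>' (l + 2) = a (l + 2) - 1"
    "\<forall>j\<ge>1. \<beta>' (l + 2 * j + 1) = 0 \<and> \<beta>' (l + 2 * j + 2) = a (l + 2 * j + 2)"
  note * = this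
  have "ostrowski_digits b a \<beta>" "ostrowski_digits b a \<beta>'"
    "t_seq a \<beta> (l + 2 * j + 1) = conv_q a (l + 2 * j + 1) - m"
    "t_seq a \<beta>' (l + 2 * j + 2) = conv_q a (l + 2 * j + 2) - m" for j
    by (rule case_B_digits_ge_2[where \<beta>' = \<beta>' and \<beta> = \<beta>, OF a b *(1,2)]; use * in blast)+
  then show ?thesis by blast
qed

lemma ostrowski_real_digits:
  assumes "\<And>k. k \<ge> 1 \<Longrightarrow> a k \<ge> 1" "b \<ge> 2" "ostrowski_real \<theta> a \<sigma> \<beta>"
  shows "ostrowski_digits b a \<beta>"
  using assms unfolding ostrowski_real_def by unfold_locales auto

subsection \<open>The continued fraction of the Sturmian number\<close>

lemma sturmian_convergents_limit:
  assumes b: "b \<ge> 2" and irr: "\<theta> \<notin> \<rat>" and cf: "has_cfrac \<theta> (\<lambda>k. real_of_int (a k))"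
    and \<xi>: "(\<xi> = xi_floor b \<theta> \<rho> \<and> digits_floor \<theta> a \<rho> \<beta>) \<or> (\<xi> = xi_ceil b \<theta> \<rho> \<and> digits_ceil \<theta> a \<rho> \<beta>)"
  shows "ostrowski_digits b a \<beta> \<and>
    (\<lambda>k. ostrowski_digits.P b a \<beta> k / ostrowski_digits.Q b a k) \<longlonglongrightarrow> \<xi>"
proof -
  have a: "a k \<ge> 1" if "k \<ge> 1" for k
    using cf that unfolding has_cfrac_def by simp
  show ?thesis
  proof (cases "case_A \<theta> \<rho>")
    case True
    then have os: "ostrowski_real \<theta> a (\<rho> - \<theta>) \<beta>"
      using \<xi> by (auto simp: digits_floor_def digits_ceil_def)
    interpret D: ostrowski_digits b a \<beta> by (rule ostrowski_real_digits[OF a b os])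
    have "(\<lambda>k. real_of_int (\<beta> (Suc k)) * theta_err \<theta> a k) sums (\<rho> - \<theta>)"
      using os by (simp add: ostrowski_real_def)
    from D.P_limit_case_A[OF cf irr True this] show ?thesis
      using \<xi> D.ostrowski_digits_axioms by auto
  next
    case False
    have fl: ?thesis if h: "\<xi> = xi_floor b \<theta> \<rho>" "digits_floor \<theta> a \<rho> \<beta>"
    proof -
      obtain m y l \<gamma> \<gamma>' where B: "\<rho> - \<theta> = - real_of_int m * \<theta> + real_of_int y"
        "case_B_digits a m l \<gamma> \<gamma>'" "\<beta> = (if odd l then \<gamma> else \<gamma>')"
        using h(2) False unfolding digits_floor_def by auto
      note sh = case_B_digits_shift[OF a b B(2)]
      interpret D: ostrowski_digits b a \<beta> using sh B(3) by (cases "odd l") auto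
      have "\<exists>k\<ge>K. even k \<and> D.t k = D.q k - m" for K
      proof (cases "odd l")
        case True
        then show ?thesis using sh B(3) by (intro exI[of _ "l + 2 * K + 1"]) (auto simp del: cden.simps)
      next
        case False
        then show ?thesis using sh B(3) by (intro exI[of _ "l + 2 * K + 2"]) (auto simp del: cden.simps)
      qed
      from D.P_limit_case_B_floor[OF cf irr B(1) this] show ?thesis
        using h D.ostrowski_digits_axioms by auto
    qed
    have ce: ?thesis if h: "\<xi> = xi_ceil b \<theta> \<rho>" "digits_ceil \<theta> a \<rho> \<beta>"
    proof -
      obtain m y l \<gamma> \<gamma>' where B: "\<rho> - \<theta> = - real_of_int m * \<theta> + real_of_int y"
        "case_B_digits a m l \<gamma> \<gamma>'" "\<beta> = (if odd l then \<gamma>' else \<gamma>)"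
        using h(2) False unfolding digits_ceil_def by auto
      note sh = case_B_digits_shift[OF a b B(2)]
      interpret D: ostrowski_digits b a \<beta> using sh B(3) by (cases "odd l") auto
      have "\<exists>k\<ge>K. odd k \<and> D.t k = D.q k - m" for K
      proof (cases "odd l")
        case True
        then show ?thesis using sh B(3) by (intro exI[of _ "l + 2 * K + 2"]) (auto simp del: cden.simps)
      next
        case False
        then show ?thesis using sh B(3) by (intro exI[of _ "l + 2 * K + 1"]) (auto simp del: cden.simps)
      qed
      from D.P_limit_case_B_ceil[OF cf irr B(1) this] show ?thesis
        using h D.ostrowski_digits_axioms by auto
    qed
    show ?thesis using \<xi> fl ce by blast
  qed
qed

theorem theorem2p3:
  fixes b :: nat and \<theta> \<rho> \<xi> :: real and a \<beta> :: "nat \<Rightarrow> int"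
  assumes "b \<ge> 2"
    and "0 < \<theta>" and "\<theta> < 1" and "\<theta> \<notin> \<rat>"
    and "0 \<le> \<rho>" and "\<rho> < 1"
    and "has_cfrac \<theta> (\<lambda>k. real_of_int (a k))"
    and "(\<xi> = xi_floor b \<theta> \<rho> \<and> digits_floor \<theta> a \<rho> \<beta>) \<or>
         (\<xi> = xi_ceil b \<theta> \<rho> \<and> digits_ceil \<theta> a \<rho> \<beta>)"
  shows "((\<forall>k\<ge>1. a k - \<beta> k \<ge> 2 \<and> \<beta> k \<ge> 1) \<longrightarrow>
           has_cfrac \<xi> (\<lambda>j. if j = 1 then c_seq b a \<beta> 0 + 1 else raw_seq b a \<beta> (j + 1)))
       \<and> (\<not> (\<forall>k\<ge>1. a k - \<beta> k \<ge> 2 \<and> \<beta> k \<ge> 1) \<longrightarrow>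
           (\<exists>A. rule_ii (rule_i (raw_seq b a \<beta>)) A) \<and>
           (\<forall>A. rule_ii (rule_i (raw_seq b a \<beta>)) A \<longrightarrow> has_cfrac \<xi> A))"
proof -
  note lim = sturmian_convergents_limit[OF assms(1,4,7,8)]
  interpret D: ostrowski_digits b a \<beta> using lim by blast
  have "has_cfrac \<xi> A" if "rule_ii D.T A" for A
    using D.rule_ii_has_cfrac[OF _ that] lim by blast
  \<comment> \<open>The explicit expansion for digits that are neither 0 nor close to full is itself
    a result of rule (ii), so both cases follow from the same limit.\<close>
  then show ?thesis using D.rule_ii_generic D.rule_ii_T_exists by blast
qed

end
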